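(* Let $\kappa<0$, $n\in\{1,2,\dots\}$ and $\nu\in\{+,-\}$, and consider the problem $$-u''(x)=\lambda u(x)\,[1+\kappa (u'(x))^2]^{3/2},\quad 0<x<1,\qquad u(0)=u(1)=0. \qquad (\mathrm{P}_\lambda)$$ Then: (1) Problem $(\mathrm{P}_\lambda)$ has an $S_n^\nu$-solution if and only if $n^2\pi^2<\lambda<\infty$. (2) The $S_n^\nu$-solution of $(\mathrm{P}_\lambda)$ is unique if it exists. Denote it by $u_\lambda$. (3) For all $\lambda$ with $n^2\pi^2<\lambda<\infty$, all of the humps of $u_\lambda$ are the same, and the first hump is symmetric around $\frac{1}{2n}$. (4) $\nu u_\lambda'(0)$ is strictly increasing as a function of $\lambda\in(n^2\pi^2,\infty)$. (5) $u_\lambda$ satisfies $$\lim_{\lambda\uparrow\infty}\|u_\lambda\|_\infty\le\frac{1}{2n\sqrt{-\kappa}}\qquad\text{and}\qquad \lim_{\lambda\downarrow n^2\pi^2}\|u_\lambda\|_\infty=\lim_{\lambda\downarrow n^2\pi^2}u_\lambda\Big(\frac{1}{2n}\Big)=0.$$ (6) The pointwise limit $u_\infty:=\lim_{\lambda\uparrow\infty}u_\lambda$ satisfies $$u_\infty'\Big(\frac jn\Big)=\nu(-1)^j\frac{1}{\sqrt{-\kappa}},\qquad j\in\{0,1,\dots,n\}.$$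
   Context: $C^1_0[0,1]$ is the space of $C^1$ functions on $[0,1]$ vanishing at $0$ and $1$. For $n\in\{1,2,\dots\}$ and $\nu\in\{+,-\}$, $$S_n^\nu:=\{u\in C_0^1[0,1] : u \text{ has exactly } n-1 \text{ simple zeros in } (0,1), \text{ and } \nu u \text{ is positive near } 0\}$$ (positive near $0$ means on some interval $(0,\varepsilon)$; $\nu$ is identified with $\pm1$). A zero $\tau$ of $u$ is simple if $u'(\tau)\neq 0$. An $S_n^\nu$-solution is a (classical, $C^2$) solution $u$ of the problem, with $1+\kappa (u')^2>0$ on $[0,1]$, such that $u\in S_n^\nu$. A hump (bump) of $u$ is the restriction of $u$ to an interval between two consecutive zeros of $u$; two humps are the same if, up to a translation in $x$ and possibly a change of sign of $u$, their graphs coincide. Derivatives at the endpoints $0$ and $1$ are one-sided. *)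

theory Defs
  imports "HOL-Analysis.Analysis"
begin

text \<open>
  A function on the interval [0,1] is represented by a function of type real to real of which only
  the values on [0,1] matter.  Derivatives are taken within [0,1], hence they are the ordinary
  derivatives in the interior and one-sided at 0 and 1.
\<close>

definition D01 :: "(real \<Rightarrow> real) \<Rightarrow> real \<Rightarrow> real" where
  "D01 u x = vector_derivative u (at x within {0..1})"

definition C1_01 :: "(real \<Rightarrow> real) \<Rightarrow> bool" where
  "C1_01 u \<longleftrightarrow> u differentiable_on {0..1} \<and> continuous_on {0..1} (D01 u)"

definition C2_01 :: "(real \<Rightarrow> real) \<Rightarrow> bool" where
  "C2_01 u \<longleftrightarrow> C1_01 u \<and> C1_01 (D01 u)"

text \<open>
  The sign \<open>\<nu>\<close> is the real number 1 or -1.  There are exactly \<open>n - 1\<close> zeros in (0,1), all of them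
  simple; finiteness is required because \<open>card\<close> is 0 on infinite sets.
\<close>

definition S_set :: "nat \<Rightarrow> real \<Rightarrow> (real \<Rightarrow> real) set" where
  "S_set n \<nu> = {u. C1_01 u \<and> u 0 = 0 \<and> u 1 = 0
     \<and> finite {x \<in> {0<..<1}. u x = 0}
     \<and> card {x \<in> {0<..<1}. u x = 0} = n - 1
     \<and> (\<forall>x\<in>{0<..<1}. u x = 0 \<longrightarrow> D01 u x \<noteq> 0)
     \<and> (\<exists>\<epsilon>>0. \<epsilon> \<le> 1 \<and> (\<forall>x\<in>{0<..<\<epsilon>}. \<nu> * u x > 0))}"

definition solves_P :: "real \<Rightarrow> real \<Rightarrow> (real \<Rightarrow> real) \<Rightarrow> bool" where
  "solves_P \<kappa> l u \<longleftrightarrow> C2_01 u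
     \<and> (\<forall>x\<in>{0<..<1}. - D01 (D01 u) x = l * u x * (1 + \<kappa> * (D01 u x)\<^sup>2) powr (3/2))
     \<and> u 0 = 0 \<and> u 1 = 0"

definition S_solution :: "real \<Rightarrow> nat \<Rightarrow> real \<Rightarrow> real \<Rightarrow> (real \<Rightarrow> real) \<Rightarrow> bool" where
  "S_solution \<kappa> n \<nu> l u \<longleftrightarrow> solves_P \<kappa> l u
     \<and> (\<forall>x\<in>{0..1}. 1 + \<kappa> * (D01 u x)\<^sup>2 > 0)
     \<and> u \<in> S_set n \<nu>"

definition sup_norm01 :: "(real \<Rightarrow> real) \<Rightarrow> real" where
  "sup_norm01 u = (SUP x\<in>{0..1}. \<bar>u x\<bar>)"

definition consecutive_zeros :: "(real \<Rightarrow> real) \<Rightarrow> real \<Rightarrow> real \<Rightarrow> bool" where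
  "consecutive_zeros u a b \<longleftrightarrow> 0 \<le> a \<and> a < b \<and> b \<le> 1 \<and> u a = 0 \<and> u b = 0
     \<and> (\<forall>x\<in>{a<..<b}. u x \<noteq> 0)"

text \<open>A hump is identified with its graph, a subset of the plane.\<close>

definition hump :: "(real \<Rightarrow> real) \<Rightarrow> real \<Rightarrow> real \<Rightarrow> (real \<times> real) set" where
  "hump u a b = (\<lambda>x. (x, u x)) ` {a..b}"

definition humps :: "(real \<Rightarrow> real) \<Rightarrow> (real \<times> real) set set" where
  "humps u = {hump u a b | a b. consecutive_zeros u a b}"

definition same_hump :: "(real \<times> real) set \<Rightarrow> (real \<times> real) set \<Rightarrow> bool" where
  "same_hump H K \<longleftrightarrow> (\<exists>s. \<exists>\<sigma>\<in>{1, -1}. (\<lambda>(x, y). (x + s, \<sigma> * y)) ` H = K)"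

definition symmetric_around :: "real \<Rightarrow> (real \<times> real) set \<Rightarrow> bool" where
  "symmetric_around c H \<longleftrightarrow> (\<lambda>(x, y). (2 * c - x, y)) ` H = H"

end

theory Submission
  imports Defs
begin

text \<open>
Write \<open>\<kappa> = - c\<^sup>2\<close> and \<open>s = sqrt \<lambda>\<close>.  Since \<open>z / sqrt (1 - z\<^sup>2)\<close> has the derivative
\<open>(1 - z\<^sup>2) powr (- 3/2)\<close>, the momentum \<open>p = c u' / sqrt (1 - c\<^sup>2 u'\<^sup>2)\<close> turns the equation into the
relativistic harmonic oscillator
  \<open>c u' = p / sqrt (1 + p\<^sup>2)\<close>,  \<open>p' = - \<lambda> c u\<close>.
Its right-hand side is globally Lipschitz, so a solution is determined by its value and its momentum
at 0 (\<open>oscillator_unique\<close>), and the energy \<open>sqrt (1 + p\<^sup>2) + \<lambda> c\<^sup>2 u\<^sup>2 / 2\<close> is conserved.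

Let \<open>1 + m\<close> be the energy.  The substitution \<open>c s u = sqrt (2 m) sin \<theta>\<close> makes the energy equation
read \<open>sqrt (1 + p\<^sup>2) = 1 + m cos\<^sup>2 \<theta>\<close>, and the angle \<open>\<theta>\<close> satisfies
  \<open>s dx/d\<theta> = (1 + m cos\<^sup>2 \<theta>) / sqrt (1 + m cos\<^sup>2 \<theta> / 2)\<close>.
Integrating the right-hand side gives the rescaled time \<open>s x\<close> as a function \<open>clock m\<close> of the angle;
its inverse \<open>phase m\<close> yields, for \<open>\<lambda> > 0\<close>, all solutions that vanish at 0 in closed form,
\<open>\<plusminus> wave c s m\<close> (\<open>solution_is_signed_wave\<close>); for \<open>\<lambda> \<le> 0\<close> the boundary value problem has only the
trivial solution (\<open>parameter_pos\<close>).  The zeros of such a function are the integer multiples of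
\<open>half_period m / s\<close>, so it has exactly \<open>n - 1\<close> zeros in (0,1) and vanishes at 1 precisely when
\<open>sqrt \<lambda> = n half_period m\<close> (\<open>S_solution_is_wave\<close>, \<open>sign_wave_S_solution\<close>).

The rest follows from properties of \<open>half_period\<close>.  It is continuous, strictly increasing and
unbounded with \<open>half_period 0 = \<pi>\<close>, which gives existence exactly for \<open>\<lambda> > n\<^sup>2 \<pi>\<^sup>2\<close>, uniqueness, and
the monotonicity of \<open>m\<close>, hence of the initial slope, in \<open>\<lambda>\<close>.  The symmetries
\<open>phase m (t + half_period m) = phase m t + \<pi>\<close> and \<open>phase m (half_period m - t) = \<pi> - phase m t\<close>
give the statements on humps.  The maximum of \<open>\<bar>u\<bar>\<close> is \<open>sqrt (2 m) / (c s)\<close>; as \<open>\<lambda>\<close> decreases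
to \<open>n\<^sup>2 \<pi>\<^sup>2\<close>, \<open>m\<close> tends to 0, and as \<open>\<lambda>\<close> grows, \<open>half_period m = 2 sqrt (2 m) + O(1)\<close> shows that
the maximum tends to \<open>1 / (2 n c)\<close> (\<open>amplitude_limit_at_top\<close>).  Because \<open>\<bar>u'\<bar> < 1 / c\<close>, a
quarter wave that reaches almost the height \<open>1 / (2 n c)\<close> at distance \<open>1 / (2 n)\<close> from its zero must
be close to a line of slope \<open>1 / c\<close>; so the limit is the triangle wave
\<open>arcsin (sin (n \<pi> x)) / (c n \<pi>)\<close> (\<open>wave_limit_triangle\<close>), whose derivative at \<open>j / n\<close> is read off
from the chain rule.
\<close>

section \<open>Time dilation along an orbit\<close>

text \<open>
The factor by which, at the phase \<open>\<theta>\<close> with \<open>s = m cos\<^sup>2 \<theta>\<close>, the oscillator of energy \<open>1 + m\<close> is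
slower than the classical harmonic oscillator.
\<close>

definition time_dilation :: "real \<Rightarrow> real" where
  "time_dilation s = (1 + s) / sqrt (1 + s / 2)"

text \<open>
With \<open>q = sqrt (1 + s / 2)\<close> the factor is \<open>2 q - 1 / q\<close>, a form in which its monotonicity and its
Lipschitz bound are evident.
\<close>

lemma time_dilation_eq:
  assumes "s \<ge> 0"
  shows "time_dilation s = 2 * sqrt (1 + s / 2) - 1 / sqrt (1 + s / 2)"
proof -
  have "sqrt (1 + s / 2) * sqrt (1 + s / 2) = 1 + s / 2" "sqrt (1 + s / 2) > 0"
    using assms by auto
  then show ?thesis
    by (simp add: time_dilation_def field_simps)
qed

lemma time_dilation_strict_mono:
  assumes "0 \<le> s" "s < t"
  shows "time_dilation s < time_dilation t"
proof -
  have "0 < sqrt (1 + s / 2)" "sqrt (1 + s / 2) < sqrt (1 + t / 2)"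
    using assms by auto
  then have "1 / sqrt (1 + t / 2) < 1 / sqrt (1 + s / 2)"
    by (simp add: frac_less2)
  then show ?thesis
    unfolding time_dilation_eq[OF assms(1)] time_dilation_eq[OF order.trans[OF assms(1) less_imp_le[OF assms(2)]]]
    using \<open>sqrt (1 + s / 2) < sqrt (1 + t / 2)\<close> by linarith
qed

lemma time_dilation_0 [simp]: "time_dilation 0 = 1"
  by (simp add: time_dilation_def)

lemma time_dilation_ge_1: "s \<ge> 0 \<Longrightarrow> time_dilation s \<ge> 1"
  using time_dilation_strict_mono[of 0 s] by (cases "s = 0") auto

lemma time_dilation_lipschitz:
  assumes "0 \<le> s" "s \<le> t"
  shows "time_dilation t - time_dilation s \<le> t - s"
proof -
  define p q where "p = sqrt (1 + s / 2)" and "q = sqrt (1 + t / 2)"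
  have p: "1 \<le> p" "p \<le> q" "p\<^sup>2 = 1 + s / 2" "q\<^sup>2 = 1 + t / 2"
    using assms by (auto simp: p_def q_def)
  have "1 / p - 1 / q = (q - p) * (1 / (p * q))"
    using p by (simp add: field_simps)
  also have "\<dots> \<le> (q - p) * 1"
  proof (rule mult_left_mono)
    have "1 \<le> p * q"
      using p mult_mono[of 1 p 1 q] by simp
    then show "1 / (p * q) \<le> 1"
      by simp
  qed (use p in simp)
  finally have "time_dilation t - time_dilation s \<le> 3 * (q - p)"
    using assms by (simp add: time_dilation_eq p_def q_def)
  moreover have "2 * (q - p) \<le> (q + p) * (q - p)"
    using p by (intro mult_right_mono) auto
  moreover have "(q + p) * (q - p) = (t - s) / 2"
    using p by (simp add: algebra_simps power2_eq_square)
  ultimately show ?thesis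
    using assms by (simp)
qed

text \<open>
For large \<open>s\<close> the factor is asymptotic to \<open>sqrt (2 s)\<close>, with an error that is bounded uniformly
in \<open>s\<close>; both bounds follow by squaring.
\<close>

lemma time_dilation_bounds:
  assumes "s \<ge> 0"
  shows "sqrt (2 * s) \<le> time_dilation s" "time_dilation s \<le> 2 + sqrt (2 * s)"
proof -
  have pos: "time_dilation s \<ge> 0"
    using time_dilation_ge_1[OF assms] by simp
  have sq: "(time_dilation s)\<^sup>2 = (1 + s)\<^sup>2 / (1 + s / 2)"
    using assms by (simp add: time_dilation_def power_divide)
  have "2 * s \<le> (time_dilation s)\<^sup>2"
    unfolding sq using assms by (simp add: pos_le_divide_eq power2_eq_square algebra_simps)
  then show "sqrt (2 * s) \<le> time_dilation s"
    using pos by (rule real_le_lsqrt[rotated])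
  have "(time_dilation s)\<^sup>2 \<le> 4 + 2 * s"
    unfolding sq using assms by (simp add: pos_divide_le_eq power2_eq_square algebra_simps)
  also have "\<dots> \<le> (2 + sqrt (2 * s))\<^sup>2"
    using assms by (simp add: power2_eq_square algebra_simps)
  finally show "time_dilation s \<le> 2 + sqrt (2 * s)"
    using assms by (intro power2_le_imp_le[of "time_dilation s"]) auto
qed

section \<open>The half period as a function of the energy\<close>

text \<open>
The oscillator of energy \<open>1 + m\<close> and frequency parameter \<open>\<lambda> = 1\<close>, started at phase 0, needs the
time \<open>clock m \<theta>\<close> to reach the phase \<open>\<theta>\<close>.
\<close>

definition clock :: "real \<Rightarrow> real \<Rightarrow> real" where
  "clock m \<theta> = (LBINT t=0..\<theta>. time_dilation (m * (cos t)\<^sup>2))"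

definition half_period :: "real \<Rightarrow> real" where
  "half_period m = clock m pi"

lemma clock_0 [simp]: "clock m 0 = 0"
  by (simp add: clock_def flip: zero_ereal_def)

lemma clock_deriv:
  assumes "m \<ge> 0"
  shows "(clock m has_real_derivative time_dilation (m * (cos \<theta>)\<^sup>2)) (at \<theta>)"
proof -
  define r where "r = \<bar>\<theta>\<bar> + 1"
  have "sqrt (1 + m * (cos t)\<^sup>2 / 2) > 0" for t
    using assms by (simp add: add_pos_nonneg)
  then have "sqrt (1 + m * (cos t)\<^sup>2 / 2) \<noteq> 0" for t
    by (rule less_imp_neq[symmetric])
  then have "continuous_on {-r..r} (\<lambda>t. time_dilation (m * (cos t)\<^sup>2))"
    unfolding time_dilation_def by (intro continuous_intros ballI) simp_all
  then have "((\<lambda>u. LBINT t=(0::real)..u. time_dilation (m * (cos t)\<^sup>2))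
      has_vector_derivative time_dilation (m * (cos \<theta>)\<^sup>2)) (at \<theta> within {-r..r})"
    by (intro interval_integral_FTC2) (auto simp: r_def)
  moreover have "at \<theta> within {-r..r} = at \<theta>"
    by (rule at_within_interior) (auto simp: r_def)
  ultimately show ?thesis
    by (simp add: clock_def[abs_def] has_real_derivative_iff_has_vector_derivative zero_ereal_def)
qed

lemma clock_continuous: "m \<ge> 0 \<Longrightarrow> continuous_on A (clock m)"
  by (meson DERIV_continuous_on clock_deriv DERIV_subset subset_UNIV)

text \<open>
Time runs at least as fast as the phase.  This makes \<open>clock m\<close> injective and unbounded in both
directions, and its inverse Lipschitz.
\<close>

lemma clock_expansive:
  assumes "m \<ge> 0" "a \<le> b"
  shows "b - a \<le> clock m b - clock m a"
proof -
  have "clock m a - a \<le> clock m b - b"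
  proof (rule DERIV_nonneg_imp_nondecreasing[OF assms(2)])
    fix x
    show "\<exists>y. ((\<lambda>t. clock m t - t) has_real_derivative y) (at x) \<and> 0 \<le> y"
      using time_dilation_ge_1[of "m * (cos x)\<^sup>2"] assms
      by (auto intro!: exI derivative_eq_intros clock_deriv)
  qed
  then show ?thesis by simp
qed

lemma clock_odd:
  assumes "m \<ge> 0"
  shows "clock m (- \<theta>) = - clock m \<theta>"
proof -
  have "((\<lambda>\<theta>. clock m (- \<theta>) + clock m \<theta>) has_real_derivative 0) (at x)" for x
  proof -
    have "((\<lambda>\<theta>. clock m (- \<theta>)) has_real_derivative time_dilation (m * (cos (- x))\<^sup>2) * (-1)) (at x)"
      by (rule DERIV_chain2[OF clock_deriv[OF assms]]) (auto intro!: derivative_eq_intros)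
    from DERIV_add[OF this clock_deriv[OF assms, of x]] show ?thesis
      by simp
  qed
  then have "clock m (- \<theta>) + clock m \<theta> = clock m (- 0) + clock m 0"
    using DERIV_isconst_all[of "\<lambda>\<theta>. clock m (- \<theta>) + clock m \<theta>" \<theta> 0] by blast
  then show ?thesis by simp
qed

lemma clock_add_pi:
  assumes "m \<ge> 0"
  shows "clock m (\<theta> + pi) = clock m \<theta> + half_period m"
proof -
  have "((\<lambda>\<theta>. clock m (\<theta> + pi) - clock m \<theta>) has_real_derivative 0) (at x)" for x
  proof -
    have "((\<lambda>\<theta>. clock m (\<theta> + pi)) has_real_derivative time_dilation (m * (cos (x + pi))\<^sup>2) * 1) (at x)"
      by (rule DERIV_chain2[OF clock_deriv[OF assms]]) (auto intro!: derivative_eq_intros)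
    from DERIV_diff[OF this clock_deriv[OF assms, of x]] show ?thesis
      by simp
  qed
  then have "clock m (\<theta> + pi) - clock m \<theta> = clock m (0 + pi) - clock m 0"
    using DERIV_isconst_all[of "\<lambda>\<theta>. clock m (\<theta> + pi) - clock m \<theta>" \<theta> 0] by blast
  then show ?thesis by (simp add: half_period_def)
qed

text \<open>
On a quarter period the cosine is nonnegative, so that \<open>sqrt (cos\<^sup>2 \<theta>)\<close> has the elementary
antiderivative \<open>sin \<theta>\<close> there; the estimates of the half period are therefore carried out on
the quarter period.
\<close>

lemma half_period_eq_quarter:
  assumes "m \<ge> 0"
  shows "half_period m = 2 * clock m (pi / 2)"
  using clock_add_pi[OF assms, of "- pi / 2"] clock_odd[OF assms, of "pi / 2"] by simp

lemma half_period_0: "half_period 0 = pi"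
proof -
  have "((\<lambda>\<theta>. clock 0 \<theta> - \<theta>) has_real_derivative 0) (at x)" for x
    using clock_deriv[of 0 x] by (auto intro!: derivative_eq_intros)
  then have "clock 0 pi - pi = clock 0 0 - 0"
    using DERIV_isconst_all[of "\<lambda>\<theta>. clock 0 \<theta> - \<theta>" pi 0] by blast
  then show ?thesis by (simp add: half_period_def)
qed

lemma half_period_strict_mono:
  assumes "0 \<le> m" "m < m'"
  shows "half_period m < half_period m'"
proof -
  have "clock m' 0 - clock m 0 < clock m' (pi / 2) - clock m (pi / 2)"
  proof (rule DERIV_pos_imp_increasing_open[where f = "\<lambda>x. clock m' x - clock m x"])
    fix x :: real assume x: "0 < x" "x < pi / 2"
    have "cos x > 0"
      using x by (intro cos_gt_zero) auto
    then have "time_dilation (m * (cos x)\<^sup>2) < time_dilation (m' * (cos x)\<^sup>2)"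
      using assms by (intro time_dilation_strict_mono) auto
    then show "\<exists>y. ((\<lambda>x. clock m' x - clock m x) has_real_derivative y) (at x) \<and> 0 < y"
      using assms
      by (intro exI[of _ "time_dilation (m' * (cos x)\<^sup>2) - time_dilation (m * (cos x)\<^sup>2)"] conjI
          DERIV_diff clock_deriv) auto
  qed (use assms in \<open>auto intro!: continuous_intros clock_continuous\<close>)
  then show ?thesis
    using assms by (simp add: half_period_eq_quarter)
qed

lemma half_period_less_iff:
  assumes "m \<ge> 0" "m' \<ge> 0"
  shows "half_period m < half_period m' \<longleftrightarrow> m < m'"
  using half_period_strict_mono[of m m'] half_period_strict_mono[of m' m] assms
  by (cases m m' rule: linorder_cases) auto

text \<open>
This serves as the continuity of the half period: the time dilation is Lipschitz in \<open>m\<close> uniformly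
in the phase, so integration over a half period of phases preserves the bound.
\<close>

lemma half_period_lipschitz:
  assumes "0 \<le> m" "m \<le> m'"
  shows "half_period m' - half_period m \<le> pi * (m' - m)"
proof -
  have "(m' - m) * 0 - clock m' 0 + clock m 0 \<le> (m' - m) * pi - clock m' pi + clock m pi"
  proof (rule DERIV_nonneg_imp_nondecreasing[where f = "\<lambda>x. (m' - m) * x - clock m' x + clock m x"])
    fix x :: real
    have "time_dilation (m' * (cos x)\<^sup>2) - time_dilation (m * (cos x)\<^sup>2)
        \<le> m' * (cos x)\<^sup>2 - m * (cos x)\<^sup>2"
      using assms by (intro time_dilation_lipschitz mult_right_mono) auto
    also have "\<dots> = (m' - m) * (cos x)\<^sup>2"
      by (simp add: algebra_simps)
    also have "\<dots> \<le> (m' - m) * 1"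
      using assms by (intro mult_left_mono) (auto simp: abs_square_le_1)
    finally have le: "0 \<le> (m' - m) * 1 - time_dilation (m' * (cos x)\<^sup>2)
        + time_dilation (m * (cos x)\<^sup>2)"
      by simp
    have "((\<lambda>x. (m' - m) * x - clock m' x + clock m x) has_real_derivative
        (m' - m) * 1 - time_dilation (m' * (cos x)\<^sup>2) + time_dilation (m * (cos x)\<^sup>2)) (at x)"
      using assms by (intro DERIV_add DERIV_diff clock_deriv DERIV_cmult DERIV_ident) auto
    with le show "\<exists>y. ((\<lambda>x. (m' - m) * x - clock m' x + clock m x) has_real_derivative y) (at x) \<and> 0 \<le> y"
      by blast
  qed simp
  then show ?thesis
    by (simp add: half_period_def algebra_simps)
qed

text \<open>
Integration of \<open>sqrt (2 m) cos \<theta> \<le> time_dilation (m cos\<^sup>2 \<theta>) \<le> 2 + sqrt (2 m) cos \<theta>\<close> over a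
quarter period, written as the monotonicity of the difference of antiderivatives.
\<close>

lemma half_period_bounds:
  assumes "m \<ge> 0"
  shows "2 * sqrt (2 * m) \<le> half_period m" "half_period m \<le> 2 * pi + 2 * sqrt (2 * m)"
proof -
  have sqrt_eq: "sqrt (2 * (m * (cos x)\<^sup>2)) = sqrt (2 * m) * cos x" if "0 \<le> x" "x \<le> pi / 2" for x
    using that cos_ge_zero[of x] by (simp add: real_sqrt_mult)
  have "clock m 0 - sqrt (2 * m) * sin 0 \<le> clock m (pi / 2) - sqrt (2 * m) * sin (pi / 2)"
  proof (rule DERIV_nonneg_imp_nondecreasing[where f = "\<lambda>x. clock m x - sqrt (2 * m) * sin x"])
    fix x :: real assume x: "0 \<le> x" "x \<le> pi / 2"
    have "((\<lambda>x. clock m x - sqrt (2 * m) * sin x) has_real_derivative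
        time_dilation (m * (cos x)\<^sup>2) - sqrt (2 * m) * cos x) (at x)"
      using assms by (intro DERIV_diff clock_deriv DERIV_cmult DERIV_sin)
    moreover have "0 \<le> time_dilation (m * (cos x)\<^sup>2) - sqrt (2 * m) * cos x"
      using time_dilation_bounds(1)[of "m * (cos x)\<^sup>2"] assms by (simp add: sqrt_eq[OF x])
    ultimately show "\<exists>y. ((\<lambda>x. clock m x - sqrt (2 * m) * sin x) has_real_derivative y) (at x) \<and> 0 \<le> y"
      by blast
  qed simp
  then show "2 * sqrt (2 * m) \<le> half_period m"
    using assms by (simp add: half_period_eq_quarter)
  have "2 * 0 + sqrt (2 * m) * sin 0 - clock m 0
      \<le> 2 * (pi / 2) + sqrt (2 * m) * sin (pi / 2) - clock m (pi / 2)"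
  proof (rule DERIV_nonneg_imp_nondecreasing[where f = "\<lambda>x. 2 * x + sqrt (2 * m) * sin x - clock m x"])
    fix x :: real assume x: "0 \<le> x" "x \<le> pi / 2"
    have "((\<lambda>x. 2 * x + sqrt (2 * m) * sin x - clock m x) has_real_derivative
        2 * 1 + sqrt (2 * m) * cos x - time_dilation (m * (cos x)\<^sup>2)) (at x)"
      using assms by (intro DERIV_diff DERIV_add clock_deriv DERIV_cmult DERIV_sin DERIV_ident)
    moreover have "0 \<le> 2 * 1 + sqrt (2 * m) * cos x - time_dilation (m * (cos x)\<^sup>2)"
      using time_dilation_bounds(2)[of "m * (cos x)\<^sup>2"] assms by (simp add: sqrt_eq[OF x])
    ultimately show "\<exists>y. ((\<lambda>x. 2 * x + sqrt (2 * m) * sin x - clock m x) has_real_derivative y) (at x) \<and> 0 \<le> y"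
      by blast
  qed simp
  then show "half_period m \<le> 2 * pi + 2 * sqrt (2 * m)"
    using assms by (simp add: half_period_eq_quarter)
qed

lemma half_period_ge_pi: "m \<ge> 0 \<Longrightarrow> half_period m \<ge> pi"
  using clock_expansive[of m 0 pi] by (simp add: half_period_def)

lemma half_period_pos: "m \<ge> 0 \<Longrightarrow> half_period m > 0"
  using half_period_ge_pi[of m] pi_gt_zero by linarith

lemma half_period_surj:
  assumes "\<tau> > pi"
  obtains m where "m > 0" "half_period m = \<tau>"
proof -
  have "\<tau> > 0" 
    using assms pi_gt_zero by linarith
  \<comment> \<open>The lower bound \<open>2 sqrt (2 m)\<close> of the half period exceeds \<open>\<tau>\<close> at \<open>m = \<tau>\<^sup>2\<close>,
  so the intermediate value theorem applies on \<open>{0..\<tau>\<^sup>2}\<close>.\<close>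
  have "continuous_on {0..\<tau>\<^sup>2} half_period"
  proof (rule lipschitz_on_continuous_on[where L = pi], rule lipschitz_on_leI)
    fix x y :: real assume "x \<in> {0..\<tau>\<^sup>2}" "y \<in> {0..\<tau>\<^sup>2}" "x \<le> y"
    then show "dist (half_period x) (half_period y) \<le> pi * dist x y"
      using half_period_lipschitz[of x y] half_period_strict_mono[of x y]
      by (cases "x = y") (auto simp: dist_real_def)
  qed auto
  moreover have "\<tau> \<le> half_period (\<tau>\<^sup>2)"
  proof -
    have "1 * \<tau> \<le> 2 * sqrt 2 * \<tau>"
      using \<open>\<tau> > 0\<close> real_sqrt_ge_one[of 2] by (intro mult_right_mono) linarith+
    also have "\<dots> \<le> half_period (\<tau>\<^sup>2)"
      using half_period_bounds(1)[of "\<tau>\<^sup>2"] \<open>\<tau> > 0\<close> by (simp add: real_sqrt_mult)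
    finally show ?thesis
      by simp
  qed
  ultimately obtain m where "0 \<le> m" "half_period m = \<tau>"
    using IVT'[of half_period 0 \<tau> "\<tau>\<^sup>2"] assms half_period_0 by auto
  moreover have "m \<noteq> 0"
    using \<open>half_period m = \<tau>\<close> assms half_period_0 by auto
  ultimately show ?thesis
    using that[of m] by simp
qed

section \<open>The phase as a function of time\<close>

definition phase :: "real \<Rightarrow> real \<Rightarrow> real" where
  "phase m = inv (clock m)"

lemma clock_bij:
  assumes "m \<ge> 0"
  shows "bij (clock m)"
proof (rule bijI)
  have "clock m a < clock m b" if "a < b" for a b
    using clock_expansive[OF assms, of a b] that by simp
  then show "inj (clock m)"
    by (metis injI less_irrefl linorder_neqE)
  show "surj (clock m)"
    unfolding surj_def
  proof
    fix t :: real
    have "clock m (- \<bar>t\<bar>) \<le> t" "t \<le> clock m \<bar>t\<bar>"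
      using clock_expansive[OF assms, of "- \<bar>t\<bar>" 0] clock_expansive[OF assms, of 0 "\<bar>t\<bar>"]
      by simp_all
    then show "\<exists>\<theta>. t = clock m \<theta>"
      using IVT'[of "clock m" "- \<bar>t\<bar>" t "\<bar>t\<bar>"] clock_continuous[OF assms] by fastforce
  qed
qed

lemma clock_phase [simp]: "m \<ge> 0 \<Longrightarrow> clock m (phase m t) = t"
  using clock_bij[of m] by (simp add: phase_def bij_is_surj surj_f_inv_f)

lemma phase_clock [simp]: "m \<ge> 0 \<Longrightarrow> phase m (clock m \<theta>) = \<theta>"
  using clock_bij[of m] by (simp add: phase_def bij_is_inj)

text \<open>
The inverse function rule requires continuity of the inverse, which \<open>clock_expansive\<close> provides
in the form of the Lipschitz constant 1.
\<close>

lemma phase_deriv: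
  assumes "m \<ge> 0"
  shows "(phase m has_real_derivative 1 / time_dilation (m * (cos (phase m t))\<^sup>2)) (at t)"
proof -
  have "1-lipschitz_on UNIV (phase m)"
  proof (rule lipschitz_on_leI)
    fix x y :: real assume "x \<le> y"
    show "dist (phase m x) (phase m y) \<le> 1 * dist x y"
      using clock_expansive[OF assms, of "phase m x" "phase m y"]
        clock_expansive[OF assms, of "phase m y" "phase m x"] assms \<open>x \<le> y\<close>
      by (cases "phase m x \<le> phase m y") (auto simp: dist_real_def)
  qed simp
  then have "isCont (phase m) t"
    using lipschitz_on_continuous_within[of 1 UNIV] by auto
  moreover have "time_dilation (m * (cos (phase m t))\<^sup>2) \<noteq> 0"
    using time_dilation_ge_1[of "m * (cos (phase m t))\<^sup>2"] assms by auto
  ultimately have "(phase m has_real_derivative inverse (time_dilation (m * (cos (phase m t))\<^sup>2))) (at t)"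
    by (intro DERIV_inverse_function[OF clock_deriv[OF assms], where a = "t - 1" and b = "t + 1"])
       (auto simp: clock_phase[OF assms])
  then show ?thesis by (simp add: inverse_eq_divide)
qed

lemma phase_strict_mono:
  assumes "m \<ge> 0" "a < b"
  shows "phase m a < phase m b"
proof (rule ccontr)
  assume "\<not> phase m a < phase m b"
  then have "clock m (phase m b) \<le> clock m (phase m a)"
    using clock_expansive[OF assms(1), of "phase m b" "phase m a"] by simp
  then show False using assms by simp
qed

lemma phase_odd: "m \<ge> 0 \<Longrightarrow> phase m (- t) = - phase m t"
  by (metis clock_odd clock_phase phase_clock)

lemma phase_add_half_period: "m \<ge> 0 \<Longrightarrow> phase m (t + half_period m) = phase m t + pi"
  by (metis clock_add_pi clock_phase phase_clock)

lemma phase_0 [simp]: "m \<ge> 0 \<Longrightarrow> phase m 0 = 0"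
  by (metis clock_0 phase_clock)

lemma phase_quarter: "m \<ge> 0 \<Longrightarrow> phase m (half_period m / 2) = pi / 2"
  using half_period_eq_quarter[of m] phase_clock[of m "pi / 2"] by simp

lemma phase_reflect: "m \<ge> 0 \<Longrightarrow> phase m (half_period m - t) = pi - phase m t"
  using phase_add_half_period[of m "- t"] by (simp add: phase_odd)

lemma phase_add_multiple_nat:
  assumes "m \<ge> 0"
  shows "phase m (t + real k * half_period m) = phase m t + real k * pi"
proof (induction k)
  case (Suc k)
  have "phase m (t + real (Suc k) * half_period m) = phase m ((t + real k * half_period m) + half_period m)"
    by (simp add: algebra_simps)
  also have "\<dots> = phase m t + real k * pi + pi"
    by (simp only: phase_add_half_period[OF assms] Suc)
  finally show ?case
    by (simp add: algebra_simps)
qed simp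

lemma phase_add_multiple:
  assumes "m \<ge> 0"
  shows "phase m (t + of_int k * half_period m) = phase m t + of_int k * pi"
proof (cases k rule: int_cases2)
  case (nonneg n)
  then show ?thesis using phase_add_multiple_nat[OF assms, of t n] by simp
next
  case (nonpos n)
  then show ?thesis
    using phase_add_multiple_nat[OF assms, of "t - real n * half_period m" n] by simp
qed

lemma sin_phase_eq_0_iff:
  assumes "m \<ge> 0"
  shows "sin (phase m t) = 0 \<longleftrightarrow> (\<exists>k::int. t = of_int k * half_period m)"
proof
  assume "sin (phase m t) = 0"
  then obtain k :: int where "phase m t = of_int k * pi"
    by (auto simp: sin_zero_iff_int2)
  then have "phase m t = phase m (of_int k * half_period m)"
    using phase_add_multiple[OF assms, of 0 k] assms by simp
  then show "\<exists>k::int. t = of_int k * half_period m"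
    using assms by (metis clock_phase)
next
  assume "\<exists>k::int. t = of_int k * half_period m"
  then obtain k :: int where "t = of_int k * half_period m" ..
  then have "phase m t = of_int k * pi"
    using phase_add_multiple[OF assms, of 0 k] assms by simp
  then show "sin (phase m t) = 0"
    by (auto simp: sin_zero_iff_int2)
qed

section \<open>Velocity and momentum\<close>

text \<open>
The relativistic velocity of a particle of unit mass and momentum \<open>p\<close>, where the speed of light
is 1; for a solution \<open>u\<close> it equals \<open>c u'\<close>.
\<close>

definition velocity :: "real \<Rightarrow> real" where
  "velocity p = p / sqrt (1 + p\<^sup>2)"

lemma sqrt_one_plus_square_pos [simp]: "sqrt (1 + p\<^sup>2) > 0"
  by (simp add: add_pos_nonneg)

lemma velocity_deriv:
  "(velocity has_real_derivative 1 / sqrt (1 + p\<^sup>2) ^ 3) (at p)"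
proof -
  define w where "w = sqrt (1 + p\<^sup>2)"
  have w: "w > 0" "w\<^sup>2 = 1 + p\<^sup>2"
    by (auto simp: w_def add_pos_nonneg)
  have "((\<lambda>p. sqrt (1 + p\<^sup>2)) has_real_derivative p / w) (at p)"
    using sqrt_one_plus_square_pos[of p] unfolding w_def
    by (auto intro!: derivative_eq_intros simp: field_simps)
  then have "((\<lambda>p. p / sqrt (1 + p\<^sup>2)) has_real_derivative (1 * w - p * (p / w)) / (w * w)) (at p)"
    using w(1) unfolding w_def by (intro DERIV_divide DERIV_ident) auto
  also have "(1 * w - p * (p / w)) / (w * w) = (w\<^sup>2 - p\<^sup>2) / w ^ 3"
    using w(1) by (simp add: field_simps power2_eq_square power3_eq_cube)
  also have "\<dots> = 1 / w ^ 3"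
    by (simp add: w)
  finally show ?thesis
    by (simp add: velocity_def[abs_def] w_def)
qed

lemma velocity_mono_contraction:
  assumes "p \<le> q"
  shows "velocity p \<le> velocity q" "velocity q - velocity p \<le> q - p"
proof -
  show "velocity p \<le> velocity q"
    using assms
    by (rule deriv_nonneg_imp_mono[OF velocity_deriv, rotated]) (simp add: less_imp_le)
  have "p - velocity p \<le> q - velocity q"
  proof (rule deriv_nonneg_imp_mono[OF DERIV_diff[OF DERIV_ident velocity_deriv] _ assms])
    fix x :: real
    define w where "w = sqrt (1 + x\<^sup>2) ^ 3"
    have "1 \<le> w"
      unfolding w_def by (intro one_le_power) simp
    then show "0 \<le> 1 - 1 / sqrt (1 + x\<^sup>2) ^ 3"
      by (simp add: divide_le_eq flip: w_def)
  qed
  then show "velocity q - velocity p \<le> q - p" by simp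
qed

lemma velocity_strict_mono: "p < q \<Longrightarrow> velocity p < velocity q"
  by (rule DERIV_pos_imp_increasing) (auto intro!: exI velocity_deriv simp: add_pos_nonneg)

text \<open>
The velocity has slope between 0 and 1, so the difference between the velocity and the momentum is
a contraction as well.  This form is what the energy estimate for uniqueness consumes.
\<close>

lemma velocity_deviation: "\<bar>(velocity p - velocity q) - (p - q)\<bar> \<le> \<bar>p - q\<bar>"
  using velocity_mono_contraction[of p q] velocity_mono_contraction[of q p] by linarith

lemma one_minus_velocity_square: "1 - (velocity p)\<^sup>2 = 1 / (1 + p\<^sup>2)"
proof -
  have "1 + p\<^sup>2 > 0" by (simp add: add_pos_nonneg)
  then show ?thesis
    by (simp add: velocity_def power_divide field_simps)
qed

lemma velocity_less_1: "velocity p < 1"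
proof -
  have "(velocity p)\<^sup>2 < 1"
    using one_minus_velocity_square[of p] zero_less_divide_1_iff[of "1 + p\<^sup>2"]
      add_pos_nonneg[OF zero_less_one zero_le_power2[of p]] by linarith
  then show ?thesis
    by (simp add: abs_square_less_1)
qed

lemma powr_three_halves: "x \<ge> 0 \<Longrightarrow> x powr (3 / 2) = sqrt x ^ 3" for x :: real
  by (cases "x = 0") (simp_all add: powr_half_sqrt[symmetric] powr_powr flip: powr_numeral)

text \<open>
Momentum is recovered from a velocity \<open>z\<close> below the speed of light as \<open>z / sqrt (1 - z\<^sup>2)\<close>.
\<close>

lemma velocity_normalise:
  assumes "z\<^sup>2 < 1"
  shows "velocity (z / sqrt (1 - z\<^sup>2)) = z"
proof -
  have pos: "1 - z\<^sup>2 > 0" using assms by simp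
  have "1 + (z / sqrt (1 - z\<^sup>2))\<^sup>2 = 1 / (1 - z\<^sup>2)"
    using pos by (simp add: power_divide field_simps)
  then show ?thesis
    using pos by (simp add: velocity_def real_sqrt_divide)
qed

text \<open>
This derivative explains the exponent 3/2 in the differential equation: divided by
\<open>(1 - c\<^sup>2 u'\<^sup>2) powr (3/2)\<close>, the second derivative of \<open>c u\<close> becomes the derivative of the momentum.
\<close>

lemma momentum_of_velocity_deriv:
  assumes "z\<^sup>2 < 1"
  shows "((\<lambda>z. z / sqrt (1 - z\<^sup>2)) has_real_derivative 1 / (1 - z\<^sup>2) powr (3 / 2)) (at z)"
proof -
  define w where "w = sqrt (1 - z\<^sup>2)"
  have w: "w > 0" "w\<^sup>2 = 1 - z\<^sup>2"
    using assms by (auto simp: w_def)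
  have "((\<lambda>z. sqrt (1 - z\<^sup>2)) has_real_derivative - z / w) (at z)"
    unfolding w_def using assms by (auto intro!: derivative_eq_intros simp: field_simps)
  then have "((\<lambda>z. z / sqrt (1 - z\<^sup>2)) has_real_derivative (1 * w - z * (- z / w)) / (w * w)) (at z)"
    using w(1) unfolding w_def by (intro DERIV_divide DERIV_ident) auto
  also have "(1 * w - z * (- z / w)) / (w * w) = (w\<^sup>2 + z\<^sup>2) / w ^ 3"
    using w(1) by (simp add: field_simps power2_eq_square power3_eq_cube)
  also have "\<dots> = 1 / (1 - z\<^sup>2) powr (3 / 2)"
    using assms by (simp add: w powr_three_halves flip: w_def)
  finally show ?thesis .
qed

section \<open>Uniqueness for the initial value problem\<close>

text \<open>
With \<open>s = sqrt l\<close>, the squared distance \<open>d = (s c (u - v))\<^sup>2 + (p - q)\<^sup>2\<close> of two solutions satisfies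
\<open>d' \<le> s d\<close>: for the harmonic oscillator it would be constant, and the deviation of velocity from
momentum costs at most the factor \<open>s\<close>.  Hence \<open>d exp (- s x)\<close> is nonincreasing, and it starts at 0.
\<close>

lemma oscillator_unique:
  fixes u v p q :: "real \<Rightarrow> real"
  assumes "l > 0" "c > 0"
    and cont: "continuous_on {0..1} u" "continuous_on {0..1} v"
      "continuous_on {0..1} p" "continuous_on {0..1} q"
    and u: "\<And>x. x \<in> {0<..<1} \<Longrightarrow> (u has_real_derivative velocity (p x) / c) (at x)"
    and v: "\<And>x. x \<in> {0<..<1} \<Longrightarrow> (v has_real_derivative velocity (q x) / c) (at x)"
    and p: "\<And>x. x \<in> {0<..<1} \<Longrightarrow> (p has_real_derivative - (l * c * u x)) (at x)"
    and q: "\<And>x. x \<in> {0<..<1} \<Longrightarrow> (q has_real_derivative - (l * c * v x)) (at x)"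
    and init: "u 0 = v 0" "p 0 = q 0"
    and x: "x \<in> {0..1}"
  shows "u x = v x"
proof -
  define s where "s = sqrt l"
  have s: "s > 0" "s\<^sup>2 = l"
    using \<open>l > 0\<close> by (auto simp: s_def)
  define d where "d = (\<lambda>x. (s * c * (u x - v x))\<^sup>2 + (p x - q x)\<^sup>2)"
  have "d x * exp (- (s * x)) \<le> d 0 * exp (- (s * 0))"
  proof (rule DERIV_nonpos_imp_decreasing_open[of 0 x])
    fix t assume t: "0 < t" "t < x"
    then have t01: "t \<in> {0<..<1}" using x by auto
    \<comment> \<open>The harmonic parts of the derivative of \<open>d\<close> cancel, which leaves only the
    deviation of velocity from momentum.\<close>
    define D where "D = 2 * (s * c * (u t - v t)) * (s * ((velocity (p t) - velocity (q t)) - (p t - q t)))"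
    have "(d has_real_derivative D) (at t)"
      unfolding d_def D_def
      by (rule derivative_eq_intros u[OF t01] v[OF t01] p[OF t01] q[OF t01] refl)+
         (use \<open>c > 0\<close> in \<open>simp add: field_simps power2_eq_square flip: s(2)\<close>)
    then have deriv: "((\<lambda>x. d x * exp (- (s * x))) has_real_derivative (D - s * d t) * exp (- (s * t))) (at t)"
      by (auto intro!: derivative_eq_intros simp: algebra_simps)
    have "D \<le> \<bar>D\<bar>" by simp
    also have "\<dots> = s * (2 * \<bar>s * c * (u t - v t)\<bar> * \<bar>(velocity (p t) - velocity (q t)) - (p t - q t)\<bar>)"
      unfolding D_def using s by (simp add: abs_mult)
    also have "\<dots> \<le> s * (2 * \<bar>s * c * (u t - v t)\<bar> * \<bar>p t - q t\<bar>)"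
      using s velocity_deviation by (intro mult_left_mono) auto
    also have "\<dots> \<le> s * d t"
      using s sum_squares_bound[of "\<bar>s * c * (u t - v t)\<bar>" "\<bar>p t - q t\<bar>"]
      by (intro mult_left_mono) (auto simp: d_def)
    finally have "(D - s * d t) * exp (- (s * t)) \<le> 0"
      by (simp add: mult_nonpos_nonneg)
    with deriv show "\<exists>y. ((\<lambda>x. d x * exp (- (s * x))) has_real_derivative y) (at t) \<and> y \<le> 0"
      by blast
  next
    show "continuous_on {0..x} (\<lambda>x. d x * exp (- (s * x)))"
      unfolding d_def using x
      by (intro continuous_intros continuous_on_subset[OF cont(1)] continuous_on_subset[OF cont(2)]
          continuous_on_subset[OF cont(3)] continuous_on_subset[OF cont(4)]) auto
  qed (use x in auto)
  then have "d x \<le> 0"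
    by (simp add: d_def init mult_le_0_iff)
  moreover have "(s * c * (u x - v x))\<^sup>2 \<le> d x"
    by (simp add: d_def)
  ultimately have "(s * c * (u x - v x))\<^sup>2 = 0"
    by (metis order.antisym order.trans zero_le_power2)
  then show ?thesis
    using s \<open>c > 0\<close> by simp
qed

section \<open>The explicit solutions\<close>

text \<open>
The solution of energy \<open>1 + m\<close> for \<open>\<lambda> = s\<^sup>2\<close> and \<open>\<kappa> = - c\<^sup>2\<close> that starts upwards from 0.
\<close>

definition wave :: "real \<Rightarrow> real \<Rightarrow> real \<Rightarrow> real \<Rightarrow> real" where
  "wave c s m x = sqrt (2 * m) / (c * s) * sin (phase m (s * x))"

text \<open>
The momentum of \<open>wave c s m\<close>, that is, the root of \<open>1 + p\<^sup>2 = (1 + m cos\<^sup>2 \<theta>)\<^sup>2\<close> with the sign of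
\<open>cos \<theta>\<close>.
\<close>

definition momentum :: "real \<Rightarrow> real \<Rightarrow> real \<Rightarrow> real" where
  "momentum s m x = sqrt m * cos (phase m (s * x)) * sqrt (2 + m * (cos (phase m (s * x)))\<^sup>2)"

lemma sqrt_one_plus_momentum_square:
  assumes "m \<ge> 0"
  shows "sqrt (1 + (momentum s m x)\<^sup>2) = 1 + m * (cos (phase m (s * x)))\<^sup>2"
proof -
  have "1 + (momentum s m x)\<^sup>2 = (1 + m * (cos (phase m (s * x)))\<^sup>2)\<^sup>2"
    using assms by (simp add: momentum_def power_mult_distrib) (simp add: power2_eq_square algebra_simps)
  then show ?thesis
    using assms by simp
qed

lemma phase_scaled_deriv:
  assumes "m \<ge> 0"
  shows "((\<lambda>x. phase m (s * x)) has_real_derivative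
      s / time_dilation (m * (cos (phase m (s * x)))\<^sup>2)) (at x)"
  using DERIV_chain2[OF phase_deriv[OF assms] DERIV_cmult_Id, of s x] by simp

lemma wave_deriv:
  assumes "m \<ge> 0" "c > 0" "s > 0"
  shows "(wave c s m has_real_derivative velocity (momentum s m x) / c) (at x)"
proof -
  define C where "C = cos (phase m (s * x))"
  have pos: "1 + m * C\<^sup>2 > 0" "2 + m * C\<^sup>2 > 0"
    using assms by (auto simp: add_pos_nonneg)
  \<comment> \<open>With this form of the root, \<open>s / time_dilation (m C\<^sup>2)\<close> contributes exactly the
  square root and the denominator of the velocity.\<close>
  have half: "sqrt (1 + m * C\<^sup>2 / 2) = sqrt (2 + m * C\<^sup>2) / sqrt 2"
    by (simp flip: real_sqrt_divide add: add_divide_distrib)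
  have "(wave c s m has_real_derivative
      sqrt (2 * m) / (c * s) * (C * (s / time_dilation (m * C\<^sup>2)))) (at x)"
    unfolding wave_def[abs_def] C_def
    by (intro DERIV_cmult DERIV_chain2[OF DERIV_sin phase_scaled_deriv[OF assms(1)]])
  also have "sqrt (2 * m) / (c * s) * (C * (s / time_dilation (m * C\<^sup>2))) = velocity (momentum s m x) / c"
    using assms pos
    by (simp add: velocity_def sqrt_one_plus_momentum_square time_dilation_def half real_sqrt_mult
        flip: C_def) (simp add: momentum_def mult_ac flip: C_def)
  finally show ?thesis .
qed

lemma momentum_deriv:
  assumes "m \<ge> 0" "c > 0" "s > 0"
  shows "(momentum s m has_real_derivative - (s\<^sup>2 * c * wave c s m x)) (at x)"
proof -
  define \<theta> where "\<theta> = phase m (s * x)"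
  define R where "R = sqrt (2 + m * (cos \<theta>)\<^sup>2)"
  have pos: "1 + m * (cos \<theta>)\<^sup>2 > 0" "2 + m * (cos \<theta>)\<^sup>2 > 0"
    using assms by (auto simp: add_pos_nonneg)
  have R: "R > 0" "R\<^sup>2 = 2 + m * (cos \<theta>)\<^sup>2"
    using pos by (auto simp: R_def)
  have half: "sqrt (1 + m * (cos \<theta>)\<^sup>2 / 2) = R / sqrt 2"
    unfolding R_def by (simp flip: real_sqrt_divide add: add_divide_distrib)
  have "((\<lambda>\<theta>. sqrt (2 + m * (cos \<theta>)\<^sup>2)) has_real_derivative - (m * cos \<theta> * sin \<theta>) / R) (at \<theta>)"
    unfolding R_def using pos by (auto intro!: derivative_eq_intros simp: field_simps)
  then have "((\<lambda>\<theta>. sqrt m * cos \<theta> * sqrt (2 + m * (cos \<theta>)\<^sup>2)) has_real_derivative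
      sqrt m * (- sin \<theta>) * R + (- (m * cos \<theta> * sin \<theta>) / R) * (sqrt m * cos \<theta>)) (at \<theta>)"
    unfolding R_def by (intro DERIV_mult DERIV_cmult DERIV_cos)
  also have "sqrt m * (- sin \<theta>) * R + (- (m * cos \<theta> * sin \<theta>) / R) * (sqrt m * cos \<theta>)
      = - sqrt m * sin \<theta> * (R\<^sup>2 + m * (cos \<theta>)\<^sup>2) / R"
    using R(1) by (simp add: field_simps power2_eq_square)
  also have "\<dots> = - 2 * sqrt m * sin \<theta> * (1 + m * (cos \<theta>)\<^sup>2) / R"
    unfolding R(2) by (simp add: algebra_simps)
  finally have "((\<lambda>x. sqrt m * cos (phase m (s * x)) * sqrt (2 + m * (cos (phase m (s * x)))\<^sup>2))
      has_real_derivative - 2 * sqrt m * sin \<theta> * (1 + m * (cos \<theta>)\<^sup>2) / R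
        * (s / time_dilation (m * (cos \<theta>)\<^sup>2))) (at x)"
    unfolding \<theta>_def by (intro DERIV_chain2[OF _ phase_scaled_deriv[OF assms(1)]])
  also have "- 2 * sqrt m * sin \<theta> * (1 + m * (cos \<theta>)\<^sup>2) / R * (s / time_dilation (m * (cos \<theta>)\<^sup>2))
      = - (s * sqrt (2 * m) * sin \<theta>)"
  proof -
    define K where "K = 1 + m * (cos \<theta>)\<^sup>2"
    have "- 2 * sqrt m * sin \<theta> * K / R * (s / (K / (R / sqrt 2))) = - (s * (2 / sqrt 2 * sqrt m) * sin \<theta>)"
      using pos(1) R(1) by (simp flip: K_def)
    then show ?thesis
      unfolding time_dilation_def half by (simp add: real_div_sqrt real_sqrt_mult flip: K_def)
  qed
  also have "\<dots> = - (s\<^sup>2 * c * wave c s m x)"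
    using assms by (simp add: wave_def \<theta>_def power2_eq_square)
  finally show ?thesis
    by (simp add: momentum_def[abs_def])
qed

lemma wave_0 [simp]: "m \<ge> 0 \<Longrightarrow> wave c s m 0 = 0"
  by (simp add: wave_def)

text \<open>
The initial momentum runs through all nonnegative numbers as \<open>m\<close> does, so every initial momentum is
that of some wave up to the sign.
\<close>

lemma momentum_0: "m \<ge> 0 \<Longrightarrow> momentum s m 0 = sqrt (m * (2 + m))"
  by (simp add: momentum_def real_sqrt_mult)

lemma wave_pos:
  assumes "m > 0" "c > 0" "s > 0" "0 < x" "s * x < half_period m"
  shows "wave c s m x > 0"
proof -
  have "phase m 0 < phase m (s * x)" "phase m (s * x) < phase m (half_period m)"
    using assms phase_strict_mono[of m 0 "s * x"] phase_strict_mono[of m "s * x" "half_period m"]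
    by auto
  then have "sin (phase m (s * x)) > 0"
    using assms phase_add_half_period[of m 0] by (intro sin_gt_zero) auto
  then show ?thesis
    using assms by (simp add: wave_def)
qed

lemma wave_eq_0_iff:
  assumes "m > 0" "c > 0" "N > 0"
  shows "wave c (N * half_period m) m x = 0 \<longleftrightarrow> (\<exists>k::int. x = of_int k / N)"
proof -
  have T: "half_period m > 0"
    using assms by (simp add: half_period_pos)
  have "wave c (N * half_period m) m x = 0 \<longleftrightarrow> sin (phase m (N * half_period m * x)) = 0"
    using assms T by (simp add: wave_def)
  also have "\<dots> \<longleftrightarrow> (\<exists>k::int. N * half_period m * x = of_int k * half_period m)"
    using assms by (simp add: sin_phase_eq_0_iff)
  also have "\<dots> \<longleftrightarrow> (\<exists>k::int. x = of_int k / N)"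
    using assms T by (intro ex_cong1) (auto simp: field_simps)
  finally show ?thesis .
qed

lemma wave_interior_zeros:
  assumes "m > 0" "c > 0" "N \<ge> 1"
  shows "{x \<in> {0<..<1}. wave c (real N * half_period m) m x = 0} = (\<lambda>k. real k / real N) ` {1..<N}"
proof (rule set_eqI, rule iffI)
  fix x assume x: "x \<in> {x \<in> {0<..<1}. wave c (real N * half_period m) m x = 0}"
  then obtain k :: int where k: "x = of_int k / real N"
    using wave_eq_0_iff[of m c "real N" x] assms by auto
  have "0 < k" "k < int N"
    using x assms unfolding k by (auto simp: zero_less_divide_iff divide_less_eq)
  then have "x = real (nat k) / real N" "nat k \<in> {1..<N}"
    using k by auto
  then show "x \<in> (\<lambda>k. real k / real N) ` {1..<N}"
    by blast
next
  fix x assume "x \<in> (\<lambda>k. real k / real N) ` {1..<N}"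
  then obtain k where k: "k \<in> {1..<N}" "x = real k / real N" by auto
  then have "x = of_int (int k) / real N" by simp
  then have "wave c (real N * half_period m) m x = 0"
    using wave_eq_0_iff[of m c "real N" x] assms by fastforce
  then show "x \<in> {x \<in> {0<..<1}. wave c (real N * half_period m) m x = 0}"
    using k by simp
qed

lemma wave_card_zeros:
  assumes "m > 0" "c > 0" "N \<ge> 1"
  shows "finite {x \<in> {0<..<1}. wave c (real N * half_period m) m x = 0}"
    and "card {x \<in> {0<..<1}. wave c (real N * half_period m) m x = 0} = N - 1"
proof -
  have "inj_on (\<lambda>k. real k / real N) {1..<N}"
    using assms by (auto simp: inj_on_def)
  then show "card {x \<in> {0<..<1}. wave c (real N * half_period m) m x = 0} = N - 1"
    unfolding wave_interior_zeros[OF assms] by (simp add: card_image)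
  show "finite {x \<in> {0<..<1}. wave c (real N * half_period m) m x = 0}"
    unfolding wave_interior_zeros[OF assms] by simp
qed

lemma sin_add_int_pi: "sin (a + of_int k * pi) = cos (of_int k * pi) * sin a" for k :: int
  using sin_zero_iff_int2[of "of_int k * pi"] by (auto simp: sin_add)

lemma cos_int_pi_sign: "cos (of_int k * pi) \<in> {1, -1}" for k :: int
proof -
  have "sin (of_int k * pi) = 0"
    using sin_zero_iff_int2[of "of_int k * pi"] by auto
  then have "(cos (of_int k * pi))\<^sup>2 = 1"
    using sin_cos_squared_add[of "of_int k * pi"] by simp
  then show ?thesis
    by (simp add: power2_eq_1_iff)
qed

lemma wave_shift:
  assumes "m \<ge> 0" "n > 0" "s = n * half_period m"
  shows "wave c s m (x + of_int k / n) = cos (of_int k * pi) * wave c s m x"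
proof -
  have "s * (x + of_int k / n) = s * x + of_int k * half_period m"
    using assms by (simp add: field_simps)
  then show ?thesis
    using phase_add_multiple[OF assms(1)] by (simp add: wave_def sin_add_int_pi)
qed

lemma wave_reflect:
  assumes "m \<ge> 0" "n > 0" "s = n * half_period m"
  shows "wave c s m (1 / n - x) = wave c s m x"
proof -
  have "s * (1 / n - x) = half_period m - s * x"
    using assms by (simp add: field_simps)
  then show ?thesis
    using phase_reflect[OF assms(1)] by (simp add: wave_def)
qed

lemma wave_odd: "m \<ge> 0 \<Longrightarrow> wave c s m (- x) = - wave c s m x"
  by (simp add: wave_def phase_odd)

lemma wave_peak:
  assumes "m \<ge> 0" "n > 0" "s = n * half_period m"
  shows "wave c s m (1 / (2 * n)) = sqrt (2 * m) / (c * s)"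
proof -
  have "s * (1 / (2 * n)) = half_period m / 2"
    using assms by (simp add: field_simps)
  then show ?thesis
    unfolding wave_def by (simp only: phase_quarter[OF assms(1)]) simp
qed

lemma wave_bound:
  assumes "m \<ge> 0" "c > 0" "s > 0"
  shows "\<bar>wave c s m x\<bar> \<le> sqrt (2 * m) / (c * s)"
proof -
  have "\<bar>wave c s m x\<bar> = sqrt (2 * m) / (c * s) * \<bar>sin (phase m (s * x))\<bar>"
    using assms by (simp add: wave_def abs_mult)
  also have "\<dots> \<le> sqrt (2 * m) / (c * s) * 1"
    using assms by (intro mult_left_mono) auto
  finally show ?thesis by simp
qed

lemma wave_slope:
  assumes "m \<ge> 0" "c > 0" "s > 0" "x \<le> y"
  shows "wave c s m y - wave c s m x \<le> (y - x) / c"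
proof -
  have "x / c - wave c s m x \<le> y / c - wave c s m y"
  proof (rule deriv_nonneg_imp_mono[OF DERIV_diff[OF DERIV_cdivide[OF DERIV_ident]
          wave_deriv[OF assms(1-3)]] _ assms(4)])
    fix x show "0 \<le> 1 / c - velocity (momentum s m x) / c"
      using velocity_less_1[of "momentum s m x"] assms by (simp add: divide_right_mono)
  qed
  then show ?thesis by (simp add: diff_divide_distrib)
qed

text \<open>
The slope never exceeds \<open>1 / c\<close>.  Comparing \<open>r\<close> with the crest at \<open>1 / (2 n)\<close> bounds the wave from
below and comparing it with the trough at \<open>- 1 / (2 n)\<close> bounds it from above; both errors are the
amount by which the amplitude misses its upper bound \<open>1 / (2 n c)\<close>.
\<close>

lemma wave_near_line:
  assumes "m \<ge> 0" "c > 0" "n > 0" and s: "s = n * half_period m"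
    and r: "- 1 / (2 * n) \<le> r" "r \<le> 1 / (2 * n)"
  shows "\<bar>wave c s m r - r / c\<bar> \<le> 1 / (2 * n * c) - sqrt (2 * m) / (c * s)"
proof -
  have "s > 0"
    using assms by (simp add: half_period_pos)
  note slope = wave_slope[OF assms(1,2) this]
  have "wave c s m (1 / (2 * n)) - wave c s m r \<le> (1 / (2 * n) - r) / c"
    "wave c s m r - wave c s m (- (1 / (2 * n))) \<le> (r - - (1 / (2 * n))) / c"
    using r slope[of r "1 / (2 * n)"] slope[of "- (1 / (2 * n))" r] by auto
  then show ?thesis
    unfolding wave_odd[OF assms(1)] wave_peak[OF assms(1,3) s]
    by (simp add: abs_le_iff add_divide_distrib diff_divide_distrib) 
qed

section \<open>Derivatives on the unit interval\<close>

lemma D01_eqI: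
  assumes "(u has_real_derivative d) (at x within {0..1})" "x \<in> {0..1}"
  shows "D01 u x = d"
  using assms vector_derivative_within_closed_interval[of 0 1 x u d]
  by (simp add: D01_def has_real_derivative_iff_has_vector_derivative)

lemma D01_cong:
  assumes "\<And>y. y \<in> {0..1} \<Longrightarrow> u y = v y" "x \<in> {0..1}"
  shows "D01 u x = D01 v x"
proof -
  have "(u has_vector_derivative d) (at x within {0..1}) \<longleftrightarrow>
      (v has_vector_derivative d) (at x within {0..1})" for d
    using has_vector_derivative_transform[of x "{0..1}" u v d]
      has_vector_derivative_transform[of x "{0..1}" v u d] assms by auto
  then show ?thesis
    by (simp add: D01_def vector_derivative_def)
qed

lemma C1_01_deriv:
  assumes "C1_01 u" "x \<in> {0..1}"
  shows "(u has_real_derivative D01 u x) (at x within {0..1})"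
  using assms vector_derivative_works[of u "at x within {0..1}"]
  by (auto simp: C1_01_def differentiable_on_def D01_def has_real_derivative_iff_has_vector_derivative)

lemma C1_01_deriv_interior:
  assumes "C1_01 u" "x \<in> {0<..<1}"
  shows "(u has_real_derivative D01 u x) (at x)"
  using C1_01_deriv[of u x] assms at_within_interior[of x "{0..1::real}"] by simp

lemma C1_01_continuous:
  assumes "C1_01 u"
  shows "continuous_on {0..1} u" "continuous_on {0..1} (D01 u)"
  using assms by (auto simp: C1_01_def differentiable_imp_continuous_on)

lemma C1_01I:
  assumes "\<And>x. x \<in> {0..1} \<Longrightarrow> (u has_real_derivative f x) (at x within {0..1})"
    and "continuous_on {0..1} f"
  shows "C1_01 u"
proof -
  have "continuous_on {0..1} (D01 u)"
    using D01_eqI[OF assms(1)] by (intro continuous_on_eq[OF assms(2)]) simp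
  then show ?thesis
    using assms(1) unfolding C1_01_def differentiable_on_def real_differentiable_def by blast
qed

section \<open>The solutions of the boundary value problem\<close>

lemma sign_wave_D01:
  assumes "m \<ge> 0" "c > 0" "s > 0" "x \<in> {0..1}"
  shows "D01 (\<lambda>x. \<nu> * wave c s m x) x = \<nu> * (velocity (momentum s m x) / c)"
  using assms by (intro D01_eqI DERIV_cmult has_field_derivative_at_within[OF wave_deriv])

lemma sign_wave_solves_P:
  assumes m: "m \<ge> 0" and c: "c > 0" and s: "s > 0" and "wave c s m 1 = 0" and "\<nu> \<in> {1, -1}"
  shows "solves_P (- c\<^sup>2) (s\<^sup>2) (\<lambda>x. \<nu> * wave c s m x)"
    and "\<forall>x\<in>{0..1}. 1 + - c\<^sup>2 * (D01 (\<lambda>x. \<nu> * wave c s m x) x)\<^sup>2 > 0"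
proof -
  let ?w = "\<lambda>x. \<nu> * wave c s m x"
  let ?v = "\<lambda>x. \<nu> * (velocity (momentum s m x) / c)"
  let ?a = "\<lambda>x. \<nu> * (1 / sqrt (1 + (momentum s m x)\<^sup>2) ^ 3 * (- (s\<^sup>2 * c * wave c s m x)) / c)"
  have cont_w: "continuous_on A (wave c s m)" and cont_p: "continuous_on A (momentum s m)" for A
    by (intro continuous_at_imp_continuous_on ballI DERIV_isCont[OF wave_deriv[OF m c s]]
        DERIV_isCont[OF momentum_deriv[OF m c s]])+
  have cont_v: "continuous_on A velocity" for A
    by (intro continuous_at_imp_continuous_on ballI DERIV_isCont[OF velocity_deriv])
  have w: "(?w has_real_derivative ?v x) (at x within {0..1})" for x
    by (intro DERIV_cmult has_field_derivative_at_within[OF wave_deriv] m c s)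
  have v: "(?v has_real_derivative ?a x) (at x within {0..1})" for x
    by (rule DERIV_cmult[OF DERIV_cdivide[OF has_field_derivative_at_within[OF
        DERIV_chain2[OF velocity_deriv momentum_deriv[OF m c s]]]]])
  have D: "D01 ?w x = ?v x" if "x \<in> {0..1}" for x
    using w that by (rule D01_eqI)
  have w2: "(D01 ?w has_real_derivative ?a x) (at x within {0..1})" if "x \<in> {0..1}" for x
    using has_field_derivative_transform_within[OF v zero_less_one that, of "D01 ?w"] D by simp
  have DD: "D01 (D01 ?w) x = ?a x" if "x \<in> {0..1}" for x
    using w2[OF that] that by (rule D01_eqI)
  have cont_vel: "continuous_on {0..1} ?v"
    using c by (intro continuous_intros continuous_on_compose2[OF cont_v cont_p]) auto
  have nz: "sqrt (1 + (momentum s m x)\<^sup>2) ^ 3 \<noteq> 0" for x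
    using sqrt_one_plus_square_pos[of "momentum s m x"] by simp
  have "continuous_on {0..1} ?a"
    by (intro continuous_intros continuous_on_compose2[OF cont_w]  continuous_on_compose2[OF cont_p])
       (use c nz in auto)
  then have "C2_01 ?w"
    unfolding C2_01_def using C1_01I[OF w cont_vel] C1_01I[OF w2] by blast
  have reg: "1 + - c\<^sup>2 * (D01 ?w x)\<^sup>2 = 1 / (1 + (momentum s m x)\<^sup>2)" if "x \<in> {0..1}" for x
    unfolding D[OF that] using assms one_minus_velocity_square[of "momentum s m x"]
    by (auto simp: power_mult_distrib power_divide)
  then show "\<forall>x\<in>{0..1}. 1 + - c\<^sup>2 * (D01 ?w x)\<^sup>2 > 0"
    by (simp add: add_pos_nonneg)
  have "- D01 (D01 ?w) x = s\<^sup>2 * ?w x * (1 + - c\<^sup>2 * (D01 ?w x)\<^sup>2) powr (3/2)"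
    if "x \<in> {0<..<1}" for x
  proof -
    have x: "x \<in> {0..1}" using that by auto
    have "(1 + - c\<^sup>2 * (D01 ?w x)\<^sup>2) powr (3/2) = 1 / sqrt (1 + (momentum s m x)\<^sup>2) ^ 3"
      unfolding reg[OF x] by (simp add: powr_three_halves real_sqrt_divide power_divide)
    then show ?thesis
      unfolding DD[OF x] using c by simp
  qed
  then show "solves_P (- c\<^sup>2) (s\<^sup>2) ?w"
    unfolding solves_P_def using \<open>C2_01 ?w\<close> assms by simp
qed

lemma sign_wave_S_solution:
  assumes "m > 0" "c > 0" "n \<ge> 1" "\<nu> \<in> {1, -1}" and s: "s = real n * half_period m"
  shows "S_solution (- c\<^sup>2) n \<nu> (s\<^sup>2) (\<lambda>x. \<nu> * wave c s m x)"
proof -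
  let ?w = "\<lambda>x. \<nu> * wave c s m x"
  have T: "half_period m > 0"
    using assms by (simp add: half_period_pos)
  then have "s > 0"
    using assms by simp
  have zero: "wave c s m x = 0 \<longleftrightarrow> (\<exists>k::int. x = of_int k / real n)" for x
    unfolding s using assms by (intro wave_eq_0_iff) auto
  have "wave c s m 1 = 0"
    unfolding zero using assms by (intro exI[of _ "int n"]) simp
  note sol = sign_wave_solves_P[OF less_imp_le[OF assms(1)] assms(2) \<open>s > 0\<close> this assms(4)]
  have zeros: "{x \<in> {0<..<1}. ?w x = 0} = {x \<in> {0<..<1}. wave c s m x = 0}"
    using assms by auto
  have simple: "D01 ?w x \<noteq> 0" if "x \<in> {0<..<1}" "?w x = 0" for x
  proof -
    have "sin (phase m (s * x)) = 0"
      using that assms \<open>s > 0\<close> by (auto simp: wave_def)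
    then have "cos (phase m (s * x)) \<noteq> 0"
      using sin_cos_squared_add[of "phase m (s * x)"] by auto
    then have "momentum s m x \<noteq> 0"
      using assms by (auto simp: momentum_def add_nonneg_eq_0_iff)
    then have "velocity (momentum s m x) \<noteq> 0"
      using sqrt_one_plus_square_pos[of "momentum s m x"] by (simp add: velocity_def)
    then show ?thesis
      using sign_wave_D01[of m c s x \<nu>] that assms \<open>s > 0\<close> by auto
  qed
  have "?w \<in> S_set n \<nu>"
  proof -
    have "C1_01 ?w"
      using sol by (simp add: solves_P_def C2_01_def)
    moreover have "\<exists>\<epsilon>>0. \<epsilon> \<le> 1 \<and> (\<forall>x\<in>{0<..<\<epsilon>}. \<nu> * ?w x > 0)"
    proof (intro exI[of _ "1 / real n"] conjI ballI)
      fix x assume x: "x \<in> {0<..<1 / real n}"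
      have "s * x < half_period m"
        using x assms T by (simp add: field_simps)
      then have "wave c s m x > 0"
        using x assms \<open>s > 0\<close> by (intro wave_pos) auto
      then show "\<nu> * ?w x > 0"
        using assms by auto
    qed (use assms in auto)
    ultimately show ?thesis
      unfolding S_set_def mem_Collect_eq zeros
      using sol(1) wave_card_zeros[OF assms(1-3)] simple unfolding solves_P_def s[symmetric] by blast
  qed
  then show ?thesis
    using sol by (simp add: S_solution_def)
qed

text \<open>
For \<open>l \<le> 0\<close> the function \<open>u u'\<close> has the derivative
\<open>u'\<^sup>2 - l u\<^sup>2 (1 + \<kappa> u'\<^sup>2) powr (3/2) \<ge> 0\<close> and vanishes at both ends, hence everywhere; so \<open>u\<^sup>2\<close> is
constant and the solution is trivial.
\<close>

lemma parameter_pos: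
  assumes sol: "solves_P \<kappa> l u"
    and nontrivial: "x0 \<in> {0<..<1}" "u x0 \<noteq> 0"
  shows "l > 0"
proof (rule ccontr)
  assume "\<not> l > 0"
  have C1: "C1_01 u" "C1_01 (D01 u)"
    using sol by (auto simp: solves_P_def C2_01_def)
  define F where "F = (\<lambda>x. u x * D01 u x)"
  have cont: "continuous_on A F" "continuous_on A (\<lambda>x. (u x)\<^sup>2)" if "A \<subseteq> {0..1}" for A
    unfolding F_def using C1_01_continuous[OF C1(1)] that
    by (auto intro!: continuous_intros intro: continuous_on_subset)
  have F_mono: "F a \<le> F b" if "0 \<le> a" "a \<le> b" "b \<le> 1" for a b
  proof (rule DERIV_nonneg_imp_increasing_open[OF that(2)])
    fix x assume x: "a < x" "x < b"
    then have x01: "x \<in> {0<..<1}" using that by auto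
    have "- D01 (D01 u) x = l * u x * (1 + \<kappa> * (D01 u x)\<^sup>2) powr (3/2)"
      using sol x01 unfolding solves_P_def by blast
    then have "D01 (D01 u) x = - l * u x * (1 + \<kappa> * (D01 u x)\<^sup>2) powr (3/2)"
      by simp
    then have "u x * D01 (D01 u) x = - l * ((u x)\<^sup>2 * (1 + \<kappa> * (D01 u x)\<^sup>2) powr (3/2))"
      by (simp add: power2_eq_square)
    also have "\<dots> \<ge> 0"
      using \<open>\<not> l > 0\<close> by (intro mult_nonneg_nonneg) auto
    finally have "D01 u x * D01 u x + D01 (D01 u) x * u x \<ge> 0"
      by (simp add: mult.commute)
    moreover have "(F has_real_derivative D01 u x * D01 u x + D01 (D01 u) x * u x) (at x)"
      unfolding F_def by (intro DERIV_mult C1_01_deriv_interior C1 x01)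
    ultimately show "\<exists>y. (F has_real_derivative y) (at x) \<and> 0 \<le> y"
      by blast
  qed (use that cont in auto)
  have ends: "F 0 = 0" "F 1 = 0"
    using sol by (auto simp: solves_P_def F_def)
  have "(u x0)\<^sup>2 = (u 0)\<^sup>2"
  proof (rule DERIV_isconst_end[of 0 x0])
    fix x assume x: "0 < x" "x < x0"
    then have x01: "x \<in> {0<..<1}" using nontrivial by auto
    have "F x = 0"
      using F_mono[of 0 x] F_mono[of x 1] x01 ends by simp
    moreover have "((\<lambda>x. (u x)\<^sup>2) has_real_derivative 2 * F x) (at x)"
      using DERIV_power[OF C1_01_deriv_interior[OF C1(1) x01], of 2] by (simp add: F_def mult_ac)
    ultimately show "((\<lambda>x. (u x)\<^sup>2) has_real_derivative 0) (at x)"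
      by simp
  qed (use nontrivial cont(2) in auto)
  then show False
    using sol nontrivial by (simp add: solves_P_def)
qed

text \<open>
The energy is read off from the initial momentum \<open>p 0\<close>, as \<open>1 + m = sqrt (1 + (p 0)\<^sup>2)\<close>, and the
sign \<open>\<sigma>\<close> is that of \<open>p 0\<close>; the wave with these data has the same initial values as \<open>u\<close>.  The trivial
solution corresponds to \<open>m = 0\<close>.
\<close>

lemma solution_is_signed_wave:
  assumes "c > 0" "l > 0"
    and sol: "solves_P (- c\<^sup>2) l u"
    and reg: "\<And>x. x \<in> {0..1} \<Longrightarrow> 1 + - c\<^sup>2 * (D01 u x)\<^sup>2 > 0"
  obtains m \<sigma> where "m \<ge> 0" "\<sigma> \<in> {1, -1}" "\<And>x. x \<in> {0..1} \<Longrightarrow> u x = \<sigma> * wave c (sqrt l) m x"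
proof -
  have C1: "C1_01 u" "C1_01 (D01 u)"
    using sol by (auto simp: solves_P_def C2_01_def)
  define s where "s = sqrt l"
  have s: "s > 0" "s\<^sup>2 = l"
    using \<open>l > 0\<close> by (auto simp: s_def)
  define p where "p = (\<lambda>x. c * D01 u x / sqrt (1 - (c * D01 u x)\<^sup>2))"
  have subl: "(c * D01 u x)\<^sup>2 < 1" if "x \<in> {0..1}" for x
    using reg[OF that] by (simp add: power_mult_distrib)
  have vel: "velocity (p x) = c * D01 u x" if "x \<in> {0..1}" for x
    using velocity_normalise[OF subl[OF that]] by (simp add: p_def)
  have p_deriv: "(p has_real_derivative - (l * c * u x)) (at x)" if x: "x \<in> {0<..<1}" for x
  proof -
    have x01: "x \<in> {0..1}" using x by auto
    let ?A = "(1 - (c * D01 u x)\<^sup>2) powr (3 / 2)"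
    have A: "?A > 0" using subl[OF x01] by simp
    have "(p has_real_derivative 1 / ?A * (c * D01 (D01 u) x)) (at x)"
      unfolding p_def
      by (rule DERIV_chain2[OF momentum_of_velocity_deriv[OF subl[OF x01]]
          DERIV_cmult[OF C1_01_deriv_interior[OF C1(2) x]]])
    moreover have "- D01 (D01 u) x = l * u x * ?A"
      using sol x by (simp add: solves_P_def power_mult_distrib)
    then have "D01 (D01 u) x = - (l * u x) * ?A" by simp
    then have "1 / ?A * (c * D01 (D01 u) x) = - (l * c * u x)"
      using A by simp
    ultimately show ?thesis by metis
  qed
  have p_cont: "continuous_on {0..1} p"
    unfolding p_def using C1_01_continuous[OF C1(1)] subl
    by (intro continuous_intros) force+
  define m where "m = sqrt (1 + (p 0)\<^sup>2) - 1"
  define \<sigma> :: real where "\<sigma> = (if p 0 \<ge> 0 then 1 else -1)"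
  have m: "m \<ge> 0"
    by (simp add: m_def)
  have \<sigma>: "\<sigma> \<in> {1, -1}" "p 0 = \<sigma> * \<bar>p 0\<bar>"
    by (auto simp: \<sigma>_def)
  have vel_\<sigma>: "velocity (\<sigma> * q) = \<sigma> * velocity q" for q
    using \<sigma>(1) by (auto simp: velocity_def)
  have "m * (2 + m) = (m + 1)\<^sup>2 - 1"
    by (simp add: power2_eq_square algebra_simps)
  also have "\<dots> = (p 0)\<^sup>2"
    by (simp add: m_def)
  finally have mom0: "p 0 = \<sigma> * momentum s m 0"
    using \<sigma>(2) m by (simp add: momentum_0)
  note wd = wave_deriv[OF m \<open>c > 0\<close> s(1)] and md = momentum_deriv[OF m \<open>c > 0\<close> s(1)]
  have "u x = \<sigma> * wave c s m x" if "x \<in> {0..1}" for x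
  proof (rule oscillator_unique[OF \<open>l > 0\<close> \<open>c > 0\<close> C1_01_continuous(1)[OF C1(1)] _ p_cont,
        where v = "\<lambda>x. \<sigma> * wave c s m x" and q = "\<lambda>x. \<sigma> * momentum s m x"])
    show "continuous_on {0..1} (\<lambda>x. \<sigma> * wave c s m x)"
      by (intro continuous_at_imp_continuous_on ballI DERIV_isCont[OF DERIV_cmult[OF wd]])
    show "continuous_on {0..1} (\<lambda>x. \<sigma> * momentum s m x)"
      by (intro continuous_at_imp_continuous_on ballI DERIV_isCont[OF DERIV_cmult[OF md]])
    show "(u has_real_derivative velocity (p x) / c) (at x)" if "x \<in> {0<..<1}" for x
      using C1_01_deriv_interior[OF C1(1) that] vel[of x] that \<open>c > 0\<close> by simp
    show "((\<lambda>x. \<sigma> * wave c s m x) has_real_derivative velocity (\<sigma> * momentum s m x) / c) (at x)" for x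
      using DERIV_cmult[OF wd, of \<sigma> x] by (simp add: vel_\<sigma>)
    show "((\<lambda>x. \<sigma> * momentum s m x) has_real_derivative - (l * c * (\<sigma> * wave c s m x))) (at x)" for x
      using DERIV_cmult[OF md, of \<sigma> x] by (simp add: s(2) mult_ac)
    show "u 0 = \<sigma> * wave c s m 0"
      using sol m by (simp add: solves_P_def)
  qed (use that p_deriv mom0 in auto)
  with that[OF m \<sigma>(1)] show thesis
    by (simp add: s_def)
qed

text \<open>
The sign near 0 excludes \<open>m = 0\<close> and fixes the sign of the wave.  The boundary condition at 1 says
that the unit interval consists of some number \<open>N\<close> of half periods, and counting the interior zeros
gives \<open>N = n\<close>.
\<close>

lemma S_solution_is_wave:
  assumes "c > 0" "n \<ge> 1" "\<nu> \<in> {1, -1}" and S: "S_solution (- c\<^sup>2) n \<nu> l u"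
  obtains m where "m > 0" "sqrt l = real n * half_period m" "l > 0"
    "\<And>x. x \<in> {0..1} \<Longrightarrow> u x = \<nu> * wave c (sqrt l) m x"
proof -
  have sol: "solves_P (- c\<^sup>2) l u"
    and reg: "\<And>x. x \<in> {0..1} \<Longrightarrow> 1 + - c\<^sup>2 * (D01 u x)\<^sup>2 > 0"
    using S by (auto simp: S_solution_def)
  obtain \<epsilon> where \<epsilon>: "\<epsilon> > 0" "\<epsilon> \<le> 1" "\<And>x. x \<in> {0<..<\<epsilon>} \<Longrightarrow> \<nu> * u x > 0"
    using S by (auto simp: S_solution_def S_set_def)
  have card_u: "card {x \<in> {0<..<1}. u x = 0} = n - 1"
    using S by (auto simp: S_solution_def S_set_def)
  have "\<epsilon> / 2 \<in> {0<..<1}" "u (\<epsilon> / 2) \<noteq> 0"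
    using \<epsilon>(1,2) \<epsilon>(3)[of "\<epsilon> / 2"] by auto
  then have l: "l > 0"
    using parameter_pos[OF sol] by blast
  define s where "s = sqrt l"
  have s: "s > 0"
    using l by (simp add: s_def)
  obtain m \<sigma> where m0: "m \<ge> 0" and \<sigma>: "\<sigma> \<in> {1, -1}"
    and u: "\<And>x. x \<in> {0..1} \<Longrightarrow> u x = \<sigma> * wave c s m x"
    using solution_is_signed_wave[OF assms(1) l sol reg] unfolding s_def by blast
  have m: "m > 0"
    using u[of "\<epsilon> / 2"] \<open>u (\<epsilon> / 2) \<noteq> 0\<close> \<epsilon>(1,2) m0 by (cases "m = 0") (auto simp: wave_def)
  define T where "T = half_period m"
  have T: "T > 0"
    using m by (simp add: T_def half_period_pos)
  \<comment> \<open>A point at which both the assumed sign of \<open>u\<close> and the positivity of the wave on its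
  first hump are known.\<close>
  define x where "x = min \<epsilon> (T / s) / 2"
  have x: "x \<in> {0<..<\<epsilon>}" "s * x < T"
  proof -
    show "x \<in> {0<..<\<epsilon>}"
      using T s \<epsilon> by (auto simp: x_def min_def)
    have "s * x \<le> s * (T / s / 2)"
      using s by (intro mult_left_mono) (auto simp: x_def)
    then show "s * x < T"
      using T s by simp
  qed
  have "wave c s m x > 0"
    using wave_pos[OF m assms(1) s, of x] x by (simp add: T_def)
  moreover have "\<nu> * (\<sigma> * wave c s m x) > 0"
    using \<epsilon>(3)[OF x(1)] u[of x] x(1) \<epsilon>(2) by simp
  ultimately have "\<sigma> = \<nu>"
    using \<sigma> assms(3) by auto
  have "u 1 = 0"
    using sol by (simp add: solves_P_def)
  then have "wave c s m 1 = 0"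
    using u[of 1] \<sigma> by auto
  then have "sin (phase m s) = 0"
    using m s assms(1) by (simp add: wave_def)
  then obtain k :: int where k: "s = of_int k * T"
    using sin_phase_eq_0_iff[OF m0] by (auto simp: T_def)
  then have "k > 0"
    using s T by (simp add: zero_less_mult_iff)
  define N where "N = nat k"
  have N: "N \<ge> 1" "s = real N * half_period m"
    using k \<open>k > 0\<close> by (auto simp: N_def T_def)
  have "{x \<in> {0<..<1}. u x = 0} = {x \<in> {0<..<1}. wave c s m x = 0}"
    using u \<sigma> by auto
  then have "n - 1 = N - 1"
    using card_u wave_card_zeros(2)[OF m assms(1) N(1)] by (simp flip: N(2))
  then have "n = N"
    using N assms(2) by simp
  show thesis
    using that[OF m _ l] u N \<open>\<sigma> = \<nu>\<close> \<open>n = N\<close> by (auto simp: s_def)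
qed

lemma S_solution_exists_iff:
  assumes "c > 0" "n \<ge> 1" "\<nu> \<in> {1, -1}"
  shows "(\<exists>u. S_solution (- c\<^sup>2) n \<nu> l u) \<longleftrightarrow> (real n)\<^sup>2 * pi\<^sup>2 < l"
proof
  assume "\<exists>u. S_solution (- c\<^sup>2) n \<nu> l u"
  then obtain u where "S_solution (- c\<^sup>2) n \<nu> l u" ..
  then obtain m where m: "m > 0" "sqrt l = real n * half_period m" "l > 0"
    using S_solution_is_wave[OF assms] by metis
  have "real n * pi < sqrt l"
    using m half_period_strict_mono[of 0 m] assms by (simp add: half_period_0)
  then have "(real n * pi)\<^sup>2 < (sqrt l)\<^sup>2"
    by (intro power_strict_mono) auto
  then show "(real n)\<^sup>2 * pi\<^sup>2 < l"
    using m(3) by (simp add: power_mult_distrib)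
next
  assume l: "(real n)\<^sup>2 * pi\<^sup>2 < l"
  have "sqrt ((real n * pi)\<^sup>2) < sqrt l"
    using l by (simp add: power_mult_distrib del: real_sqrt_abs)
  then have "real n * pi < sqrt l"
    by simp
  then have "pi < sqrt l / real n"
    using assms by (simp add: field_simps)
  then obtain m where m: "m > 0" "half_period m = sqrt l / real n"
    by (rule half_period_surj)
  have "l > 0"
    using l by (smt (verit) zero_le_power2 mult_nonneg_nonneg)
  then show "\<exists>u. S_solution (- c\<^sup>2) n \<nu> l u"
    using sign_wave_S_solution[OF m(1) assms, of "sqrt l"] m assms by auto
qed

lemma S_solution_unique:
  assumes "c > 0" "n \<ge> 1" "\<nu> \<in> {1, -1}"
    and "S_solution (- c\<^sup>2) n \<nu> l u" "S_solution (- c\<^sup>2) n \<nu> l v" "x \<in> {0..1}"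
  shows "u x = v x"
proof -
  obtain m where m: "m > 0" "sqrt l = real n * half_period m"
      "\<And>x. x \<in> {0..1} \<Longrightarrow> u x = \<nu> * wave c (sqrt l) m x"
    using S_solution_is_wave[OF assms(1-3,4)] by metis
  obtain m' where m': "m' > 0" "sqrt l = real n * half_period m'"
      "\<And>x. x \<in> {0..1} \<Longrightarrow> v x = \<nu> * wave c (sqrt l) m' x"
    using S_solution_is_wave[OF assms(1-3,5)] by metis
  have "half_period m = half_period m'"
    using m m' assms by simp
  then have "m = m'"
    using half_period_strict_mono[of m m'] half_period_strict_mono[of m' m] m m'
    by (cases m m' rule: linorder_cases) auto
  then show ?thesis
    using m m' assms by simp
qed

text \<open>
Here the energy excess becomes a function of the parameter, so that the limits in \<open>l\<close> can be taken
along an arbitrary choice of solutions.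
\<close>

lemma S_solution_family_is_wave:
  assumes "c > 0" "n \<ge> 1" "\<nu> \<in> {1, -1}"
    and "\<forall>l > l0. S_solution (- c\<^sup>2) n \<nu> l (u l)"
  obtains m where "\<And>l. l > l0 \<Longrightarrow> m l > 0" "\<And>l. l > l0 \<Longrightarrow> sqrt l = real n * half_period (m l)"
    "\<And>l. l > l0 \<Longrightarrow> l > 0"
    "\<And>l x. l > l0 \<Longrightarrow> x \<in> {0..1} \<Longrightarrow> u l x = \<nu> * wave c (sqrt l) (m l) x"
proof -
  have "\<forall>l. \<exists>m. l > l0 \<longrightarrow> m > 0 \<and> sqrt l = real n * half_period m \<and> l > 0 \<and>
      (\<forall>x\<in>{0..1}. u l x = \<nu> * wave c (sqrt l) m x)"
    using S_solution_is_wave[OF assms(1-3)] assms(4) by metis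
  then obtain m where "\<And>l. l > l0 \<Longrightarrow> m l > 0 \<and> sqrt l = real n * half_period (m l) \<and> l > 0 \<and>
      (\<forall>x\<in>{0..1}. u l x = \<nu> * wave c (sqrt l) (m l) x)"
    by metis
  then show thesis
    by (intro that[of m]) auto
qed

section \<open>Humps and the supremum norm\<close>

lemma hump_translate:
  assumes "\<And>x. x \<in> {a..b} \<Longrightarrow> u (x + d) = \<sigma> * u x"
  shows "(\<lambda>(x, y). (x + d, \<sigma> * y)) ` hump u a b = hump u (a + d) (b + d)"
proof -
  have "(\<lambda>(x, y). (x + d, \<sigma> * y)) ` hump u a b = (\<lambda>x. (x + d, u (x + d))) ` {a..b}"
    unfolding hump_def image_image using assms by (intro image_cong) auto
  also have "\<dots> = (\<lambda>x. (x, u x)) ` (\<lambda>x. x + d) ` {a..b}"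
    by (simp only: image_image)
  finally show ?thesis
    by (simp add: hump_def)
qed

lemma wave_consecutive_zeros:
  assumes "m > 0" "c > 0" "n \<ge> 1" "\<nu> \<in> {1, -1}" and s: "s = real n * half_period m"
    and u: "\<And>x. x \<in> {0..1} \<Longrightarrow> u x = \<nu> * wave c s m x"
  shows "consecutive_zeros u a b \<longleftrightarrow>
    (\<exists>i::int. 0 \<le> i \<and> i < int n \<and> a = of_int i / real n \<and> b = of_int (i + 1) / real n)"
proof
  have zero: "u x = 0 \<longleftrightarrow> (\<exists>k::int. x = of_int k / real n)" if "x \<in> {0..1}" for x
    using u[OF that] assms wave_eq_0_iff[of m c "real n" x] unfolding s by auto
  {
    assume ab: "consecutive_zeros u a b"
    then have "a \<in> {0..1}" "b \<in> {0..1}"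
      by (auto simp: consecutive_zeros_def)
    then obtain i j :: int where ij: "a = of_int i / real n" "b = of_int j / real n"
      using ab zero unfolding consecutive_zeros_def by metis
    have "0 \<le> i" "i < j" "j \<le> int n"
      using ab ij assms(3) by (auto simp: consecutive_zeros_def zero_le_divide_iff divide_less_cancel divide_le_eq)
    \<comment> \<open>Otherwise the next multiple of \<open>1 / n\<close> would be a zero strictly between \<open>a\<close> and \<open>b\<close>.\<close>
    moreover have "j = i + 1"
    proof (rule ccontr)
      assume "j \<noteq> i + 1"
      then have "of_int (i + 1) / real n \<in> {a<..<b}"
        using \<open>i < j\<close> assms(3) unfolding ij by (auto simp: divide_strict_right_mono)
      moreover from this have "of_int (i + 1) / real n \<in> {0..1}"
        using \<open>a \<in> {0..1}\<close> \<open>b \<in> {0..1}\<close> by auto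
      ultimately show False
        using ab zero unfolding consecutive_zeros_def by blast
    qed
    ultimately show "\<exists>i::int. 0 \<le> i \<and> i < int n \<and> a = of_int i / real n \<and> b = of_int (i + 1) / real n"
      using ij by auto
  }
  assume "\<exists>i::int. 0 \<le> i \<and> i < int n \<and> a = of_int i / real n \<and> b = of_int (i + 1) / real n"
  then obtain i :: int where i: "0 \<le> i" "i < int n" "a = of_int i / real n" "b = of_int (i + 1) / real n"
    by blast
  have range: "0 \<le> a" "a < b" "b \<le> 1"
    using i assms(3) by (auto simp: divide_strict_right_mono divide_le_eq)
  moreover have "u a = 0"
    using zero[of a] i(3) range by auto
  moreover have "u b = 0"
    using zero[of b] i(4) range by (metis atLeastAtMost_iff less_imp_le order.trans)
  moreover have "u x \<noteq> 0" if x: "x \<in> {a<..<b}" for x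
  proof
    assume "u x = 0"
    then obtain k :: int where "x = of_int k / real n"
      using zero[of x] x range by auto
    then have "i < k" "k < i + 1"
      using x assms(3) unfolding i by (auto simp: divide_less_cancel simp flip: of_int_add)
    then show False by simp
  qed
  ultimately show "consecutive_zeros u a b"
    by (simp add: consecutive_zeros_def)
qed

lemma wave_humps_same:
  assumes "m > 0" "c > 0" "n \<ge> 1" "\<nu> \<in> {1, -1}" and s: "s = real n * half_period m"
    and u: "\<And>x. x \<in> {0..1} \<Longrightarrow> u x = \<nu> * wave c s m x"
    and "H \<in> humps u" "K \<in> humps u"
  shows "same_hump H K"
proof -
  note zeros = wave_consecutive_zeros[of m c n \<nu> s u, OF assms(1-6)]
  obtain a b a' b' where H: "consecutive_zeros u a b" "H = hump u a b"
    and K: "consecutive_zeros u a' b'" "K = hump u a' b'"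
    using assms(7,8) by (auto simp: humps_def)
  obtain i :: int where i: "0 \<le> i" "i < int n" "a = of_int i / real n" "b = of_int (i + 1) / real n"
    using H zeros by blast
  obtain j :: int where j: "0 \<le> j" "j < int n" "a' = of_int j / real n" "b' = of_int (j + 1) / real n"
    using K zeros by blast
  define d where "d = of_int (j - i) / real n"
  define \<sigma> where "\<sigma> = cos (of_int (j - i) * pi)"
  have shift: "a' = a + d" "b' = b + d"
    unfolding i j d_def by (simp_all flip: add_divide_distrib)
  have "u (x + d) = \<sigma> * u x" if x: "x \<in> {a..b}" for x
  proof -
    have "x \<in> {0..1}" "x + d \<in> {0..1}"
      using x H(1) K(1) unfolding shift consecutive_zeros_def by auto
    then show ?thesis
      using u wave_shift[of m "real n" s c x "j - i"] assms(1,3) s by (simp add: d_def \<sigma>_def)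
  qed
  from hump_translate[of a b u d \<sigma>, OF this] have "(\<lambda>(x, y). (x + d, \<sigma> * y)) ` H = K"
    by (simp add: H K shift)
  then show ?thesis
    using cos_int_pi_sign[of "j - i"] unfolding same_hump_def \<sigma>_def by blast
qed

lemma wave_first_hump_symmetric:
  assumes "m > 0" "c > 0" "n \<ge> 1" "\<nu> \<in> {1, -1}" and s: "s = real n * half_period m"
    and u: "\<And>x. x \<in> {0..1} \<Longrightarrow> u x = \<nu> * wave c s m x"
  shows "consecutive_zeros u 0 (1 / real n)"
    and "symmetric_around (1 / (2 * real n)) (hump u 0 (1 / real n))"
proof -
  show "consecutive_zeros u 0 (1 / real n)"
  proof -
    have "\<exists>i::int. 0 \<le> i \<and> i < int n \<and> 0 = of_int i / real n \<and> 1 / real n = of_int (i + 1) / real n"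
      using assms(3) by (intro exI[of _ 0]) auto
    then show ?thesis
      using wave_consecutive_zeros[of m c n \<nu> s u, OF assms] by blast
  qed
  have n: "1 / real n \<le> 1"
    using assms(3) by simp
  have "(\<lambda>(x, y). (2 * (1 / (2 * real n)) - x, y)) ` hump u 0 (1 / real n)
      = (\<lambda>x. (1 / real n - x, u (1 / real n - x))) ` {0..1 / real n}"
    unfolding hump_def image_image
  proof (intro image_cong refl)
    fix x assume x: "x \<in> {0..1 / real n}"
    then have "x \<in> {0..1}" "1 / real n - x \<in> {0..1}"
      using n by auto
    then have "u (1 / real n - x) = u x"
      using u wave_reflect[of m "real n" s c x] assms(1,3) s by simp
    then show "(case (x, u x) of (x, y) \<Rightarrow> (2 * (1 / (2 * real n)) - x, y)) =
        (1 / real n - x, u (1 / real n - x))"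
      by simp
  qed
  also have "\<dots> = (\<lambda>x. (x, u x)) ` (\<lambda>x. 1 / real n - x) ` {0..1 / real n}"
    by (simp only: image_image)
  also have "\<dots> = hump u 0 (1 / real n)"
    by (simp add: hump_def)
  finally show "symmetric_around (1 / (2 * real n)) (hump u 0 (1 / real n))"
    by (simp add: symmetric_around_def)
qed

lemma wave_sup_norm:
  assumes "m > 0" "c > 0" "n \<ge> 1" "\<nu> \<in> {1, -1}" and s: "s = real n * half_period m"
    and u: "\<And>x. x \<in> {0..1} \<Longrightarrow> u x = \<nu> * wave c s m x"
  shows "sup_norm01 u = sqrt (2 * m) / (c * s)"
  unfolding sup_norm01_def
proof (rule cSup_eq_maximum)
  have "s > 0"
    using assms by (simp add: half_period_pos)
  have abs_u: "\<bar>u x\<bar> = \<bar>wave c s m x\<bar>" if "x \<in> {0..1}" for x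
    using u[OF that] assms(4) by auto
  have peak: "1 / (2 * real n) \<in> {0..1}"
    using assms(3) by (auto simp: divide_le_eq)
  have "\<bar>u (1 / (2 * real n))\<bar> = sqrt (2 * m) / (c * s)"
    using abs_u[OF peak] wave_peak[of m "real n" s c] assms(1-3) s \<open>s > 0\<close> by simp
  then show "sqrt (2 * m) / (c * s) \<in> (\<lambda>x. \<bar>u x\<bar>) ` {0..1}"
    using peak by (metis imageI)
  show "y \<le> sqrt (2 * m) / (c * s)" if "y \<in> (\<lambda>x. \<bar>u x\<bar>) ` {0..1}" for y
    using that abs_u wave_bound[of m c s] assms(1,2) \<open>s > 0\<close> by auto
qed

section \<open>Limits in the parameter\<close>

text \<open>
Since \<open>half_period m = 2 sqrt (2 m) + O(1)\<close> and \<open>sqrt l = n half_period (m l)\<close>, the amplitude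
differs from \<open>1 / (2 n c)\<close> by at most \<open>\<pi> / (c sqrt l)\<close>.
\<close>

lemma amplitude_limit_at_top:
  assumes "c > 0" "n > 0" "\<And>l. l > l0 \<Longrightarrow> m l \<ge> 0 \<and> sqrt l = n * half_period (m l) \<and> l > 0"
  shows "((\<lambda>l. sqrt (2 * m l) / (c * sqrt l)) \<longlongrightarrow> 1 / (2 * n * c)) at_top"
proof (rule tendsto_sandwich)
  have "((\<lambda>l. pi / (c * sqrt l)) \<longlongrightarrow> 0) at_top"
    using assms by (intro tendsto_divide_0[OF tendsto_const] filterlim_at_top_imp_at_infinity
        filterlim_tendsto_pos_mult_at_top[OF tendsto_const _ sqrt_at_top])
  from tendsto_diff[OF tendsto_const this, of "1 / (2 * n * c)"]
  show "((\<lambda>l. 1 / (2 * n * c) - pi / (c * sqrt l)) \<longlongrightarrow> 1 / (2 * n * c)) at_top"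
    by simp
  have bounds: "1 / (2 * n * c) - pi / (c * sqrt l) \<le> sqrt (2 * m l) / (c * sqrt l)"
    "sqrt (2 * m l) / (c * sqrt l) \<le> 1 / (2 * n * c)" if "l > l0" for l
  proof -
    define q S where "q = sqrt (2 * m l)" and "S = sqrt l"
    have "l > 0" and T: "half_period (m l) = S / n" and m: "m l \<ge> 0"
      using assms(2) assms(3)[OF that] by (auto simp: S_def)
    then have S: "S > 0" by (simp add: S_def)
    have "2 * q \<le> S / n" "S / n \<le> 2 * pi + 2 * q"
      using half_period_bounds[OF m] unfolding T q_def by auto
    then have "q \<le> S / (2 * n)" "S / (2 * n) - pi \<le> q"
      using assms(2) by (auto simp: field_simps)
    then have "q / (c * S) \<le> S / (2 * n) / (c * S)" "(S / (2 * n) - pi) / (c * S) \<le> q / (c * S)"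
      using assms(1) S by (intro divide_right_mono; force)+
    moreover have eq: "S / (2 * n) / (c * S) = 1 / (2 * n * c)"
      using S by simp
    moreover have "(S / (2 * n) - pi) / (c * S) = 1 / (2 * n * c) - pi / (c * S)"
      unfolding diff_divide_distrib eq ..
    ultimately show "sqrt (2 * m l) / (c * sqrt l) \<le> 1 / (2 * n * c)"
      "1 / (2 * n * c) - pi / (c * sqrt l) \<le> sqrt (2 * m l) / (c * sqrt l)"
      unfolding q_def[symmetric] S_def[symmetric] by (simp_all only:)
  qed
  show "\<forall>\<^sub>F l in at_top. 1 / (2 * n * c) - pi / (c * sqrt l) \<le> sqrt (2 * m l) / (c * sqrt l)"
    "\<forall>\<^sub>F l in at_top. sqrt (2 * m l) / (c * sqrt l) \<le> 1 / (2 * n * c)"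
    using bounds by (auto intro: eventually_mono[OF eventually_gt_at_top[of l0]])
qed simp

text \<open>
As \<open>half_period\<close> is strictly increasing with value \<open>\<pi>\<close> at 0, the energy excess \<open>m l\<close> stays below
\<open>e\<close> as long as \<open>sqrt l < n half_period e\<close>, and \<open>n\<^sup>2 \<pi>\<^sup>2\<close> is strictly below the square of that
bound.
\<close>

lemma amplitude_limit_threshold:
  assumes "c > 0" "n > 0" and l0: "l0 = n\<^sup>2 * pi\<^sup>2"
    and m: "\<And>l. l > l0 \<Longrightarrow> m l \<ge> 0 \<and> sqrt l = n * half_period (m l) \<and> l > 0"
  shows "((\<lambda>l. sqrt (2 * m l) / (c * sqrt l)) \<longlongrightarrow> 0) (at_right l0)"
proof -
  have "(m \<longlongrightarrow> 0) (at_right l0)"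
  proof (rule order_tendstoI)
    fix e :: real assume "e < 0"
    then show "\<forall>\<^sub>F l in at_right l0. e < m l"
      using m unfolding eventually_at_right_field by (intro exI[of _ "l0 + 1"]) fastforce
  next
    fix e :: real assume "e > 0"
    have "l0 < (n * half_period e)\<^sup>2"
      using half_period_strict_mono[of 0 e] \<open>e > 0\<close> assms(2) pi_gt_zero
      by (auto simp: l0 half_period_0 power_mult_distrib intro!: mult_strict_left_mono power_strict_mono)
    then show "\<forall>\<^sub>F l in at_right l0. m l < e"
    proof (rule eventually_mono[OF eventually_at_right_real])
      fix l assume l: "l \<in> {l0<..<(n * half_period e)\<^sup>2}"
      then have "sqrt l < sqrt ((n * half_period e)\<^sup>2)"
        by (simp del: real_sqrt_abs)
      then have "n * half_period (m l) < n * half_period e"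
        using m[of l] l assms(2) half_period_pos[of e] \<open>e > 0\<close> by simp
      then show "m l < e"
        using assms(2) m[of l] l \<open>e > 0\<close> half_period_less_iff[of "m l" e] by simp
    qed
  qed
  then have "((\<lambda>l. sqrt (2 * m l) / (c * sqrt l)) \<longlongrightarrow> sqrt (2 * 0) / (c * sqrt l0)) (at_right l0)"
    using assms(1,2) by (intro tendsto_intros) (auto simp: l0)
  then show ?thesis by simp
qed

text \<open>
The function \<open>arcsin (sin (n \<pi> x))\<close> is the triangle wave of slope \<open>\<plusminus> n \<pi>\<close> with zeros at the
multiples of \<open>1 / n\<close>.
\<close>

lemma triangle_wave_shift:
  assumes "n > 0" "\<bar>r\<bar> \<le> 1 / (2 * n)"
  shows "arcsin (sin (n * pi * (r + of_int k / n))) = cos (of_int k * pi) * (n * pi * r)"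
proof -
  have "n * pi * (r + of_int k / n) = n * pi * r + of_int k * pi"
    using assms(1) by (simp add: field_simps)
  then have eq: "sin (n * pi * (r + of_int k / n)) = cos (of_int k * pi) * sin (n * pi * r)"
    by (simp add: sin_add_int_pi)
  have "\<bar>n * pi * r\<bar> \<le> n * pi * (1 / (2 * n))"
    using assms unfolding abs_mult by (intro mult_mono) auto
  then have "\<bar>n * pi * r\<bar> \<le> pi / 2"
    using assms(1) by simp
  then have "arcsin (sin (n * pi * r)) = n * pi * r"
    by (intro arcsin_sin) linarith+
  then show ?thesis
    using cos_int_pi_sign[of k] unfolding eq by (auto simp: arcsin_minus)
qed

text \<open>
The kinks of the triangle wave lie halfway between its zeros, so it is differentiable at the zeros.
\<close>

lemma triangle_wave_deriv:
  assumes "n \<ge> 1"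
  shows "((\<lambda>x. arcsin (sin (real n * pi * x))) has_real_derivative (-1) ^ j * (real n * pi))
    (at (real j / real n))"
proof -
  have arg: "real n * pi * (real j / real n) = real j * pi"
    using assms by simp
  have "((\<lambda>x. sin (real n * pi * x)) has_real_derivative cos (real j * pi) * (real n * pi)) (at (real j / real n))"
    using assms by (auto intro!: derivative_eq_intros)
  moreover have "(arcsin has_real_derivative 1) (at (sin (real n * pi * (real j / real n))))"
    unfolding arg using DERIV_arcsin[of 0] by simp
  ultimately show ?thesis
    using DERIV_chain2[of arcsin 1 "\<lambda>x. sin (real n * pi * x)" "real j / real n"] by simp
qed

text \<open>
Both the waves and their limit change only by a sign under shifts by \<open>1 / n\<close>; so it suffices to
treat the distance \<open>r\<close> from the zero nearest to \<open>x\<close>, where \<open>wave_near_line\<close> applies.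
\<close>

lemma wave_limit_triangle:
  assumes "c > 0" "n > 0" and m: "\<And>l. l > l0 \<Longrightarrow> m l \<ge> 0 \<and> sqrt l = n * half_period (m l) \<and> l > 0"
  shows "((\<lambda>l. wave c (sqrt l) (m l) x) \<longlongrightarrow> arcsin (sin (n * pi * x)) / (c * n * pi)) at_top"
proof -
  define k where "k = round (n * x)"
  define r where "r = x - of_int k / n"
  have x: "x = r + of_int k / n"
    by (simp add: r_def)
  have "\<bar>of_int k - n * x\<bar> \<le> 1 / 2"
    unfolding k_def by (rule of_int_round_abs_le)
  moreover have "n * r = n * x - of_int k"
    using assms(2) by (simp add: r_def field_simps)
  ultimately have "n * \<bar>r\<bar> \<le> 1 / 2"
    using assms(2) by (metis abs_minus_commute abs_mult abs_of_pos)
  then have r: "\<bar>r\<bar> \<le> 1 / (2 * n)"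
    using assms(2) by (simp add: field_simps)
  have "((\<lambda>l. wave c (sqrt l) (m l) r - r / c) \<longlongrightarrow> 0) at_top"
  proof (rule Lim_null_comparison)
    have "\<bar>wave c (sqrt l) (m l) r - r / c\<bar> \<le> 1 / (2 * n * c) - sqrt (2 * m l) / (c * sqrt l)"
      if "l > l0" for l
      using m[OF that] r assms(1,2) by (intro wave_near_line) auto
    then show "\<forall>\<^sub>F l in at_top. norm (wave c (sqrt l) (m l) r - r / c)
        \<le> 1 / (2 * n * c) - sqrt (2 * m l) / (c * sqrt l)"
      by (auto intro: eventually_mono[OF eventually_gt_at_top[of l0]])
    show "((\<lambda>l. 1 / (2 * n * c) - sqrt (2 * m l) / (c * sqrt l)) \<longlongrightarrow> 0) at_top"
      using tendsto_diff[OF tendsto_const amplitude_limit_at_top[of c n l0 m, OF assms], of "1 / (2 * n * c)"]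
      by simp
  qed
  then have "((\<lambda>l. wave c (sqrt l) (m l) r) \<longlongrightarrow> r / c) at_top"
    by (simp add: LIM_zero_iff)
  then have lim: "((\<lambda>l. cos (of_int k * pi) * wave c (sqrt l) (m l) r) \<longlongrightarrow> cos (of_int k * pi) * (r / c)) at_top"
    by (rule tendsto_mult_left)
  have "cos (of_int k * pi) * (r / c) = arcsin (sin (n * pi * x)) / (c * n * pi)"
    unfolding x triangle_wave_shift[OF assms(2) r] using assms(1,2) by simp
  moreover have "\<forall>\<^sub>F l in at_top. cos (of_int k * pi) * wave c (sqrt l) (m l) r = wave c (sqrt l) (m l) x"
  proof (rule eventually_mono[OF eventually_gt_at_top[of l0]])
    fix l assume "l > l0"
    then show "cos (of_int k * pi) * wave c (sqrt l) (m l) r = wave c (sqrt l) (m l) x"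
      unfolding x using m wave_shift[of "m l" n "sqrt l" c r k] assms(2) by simp
  qed
  ultimately show ?thesis
    using Lim_transform_eventually[OF lim] by simp
qed

section \<open>The solution branches\<close>

theorem theorem1p2:
  fixes \<kappa> \<nu> :: real and n :: nat
  assumes "\<kappa> < 0" and "n \<ge> 1" and "\<nu> \<in> {1, -1}"
  shows
    "(\<forall>l. (\<exists>u. S_solution \<kappa> n \<nu> l u) \<longleftrightarrow> (real n)\<^sup>2 * pi\<^sup>2 < l)
     \<and> (\<forall>l u v. S_solution \<kappa> n \<nu> l u \<longrightarrow> S_solution \<kappa> n \<nu> l v \<longrightarrow> (\<forall>x\<in>{0..1}. u x = v x))
     \<and> (\<forall>u :: real \<Rightarrow> real \<Rightarrow> real.
          (\<forall>l > (real n)\<^sup>2 * pi\<^sup>2. S_solution \<kappa> n \<nu> l (u l)) \<longrightarrow>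
            (\<forall>l > (real n)\<^sup>2 * pi\<^sup>2.
                (\<forall>H\<in>humps (u l). \<forall>K\<in>humps (u l). same_hump H K)
              \<and> (\<exists>b. consecutive_zeros (u l) 0 b
                     \<and> symmetric_around (1 / (2 * real n)) (hump (u l) 0 b)))
          \<and> strict_mono_on {(real n)\<^sup>2 * pi\<^sup>2 <..} (\<lambda>l. \<nu> * D01 (u l) 0)
          \<and> (\<exists>L. ((\<lambda>l. sup_norm01 (u l)) \<longlongrightarrow> L) at_top
                 \<and> L \<le> 1 / (2 * real n * sqrt (- \<kappa>)))
          \<and> ((\<lambda>l. sup_norm01 (u l)) \<longlongrightarrow> 0) (at_right ((real n)\<^sup>2 * pi\<^sup>2))
          \<and> ((\<lambda>l. u l (1 / (2 * real n))) \<longlongrightarrow> 0) (at_right ((real n)\<^sup>2 * pi\<^sup>2))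
          \<and> (\<exists>u_inf. (\<forall>x\<in>{0..1}. ((\<lambda>l. u l x) \<longlongrightarrow> u_inf x) at_top)
                 \<and> (\<forall>j\<in>{0..n}. (u_inf has_real_derivative \<nu> * (-1) ^ j * (1 / sqrt (- \<kappa>)))
                        (at (real j / real n) within {0..1}))))"
proof (rule conjI[OF _ conjI[OF _ allI[OF impI]]])
  define c where "c = sqrt (- \<kappa>)"
  have c: "c > 0" and \<kappa>: "\<kappa> = - c\<^sup>2"
    using assms(1) by (auto simp: c_def)
  have n: "real n > 0"
    using assms(2) by simp
  show "\<forall>l. (\<exists>u. S_solution \<kappa> n \<nu> l u) \<longleftrightarrow> (real n)\<^sup>2 * pi\<^sup>2 < l"
    unfolding \<kappa> by (intro allI S_solution_exists_iff[OF c assms(2,3)])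
  show "\<forall>l u v. S_solution \<kappa> n \<nu> l u \<longrightarrow> S_solution \<kappa> n \<nu> l v \<longrightarrow> (\<forall>x\<in>{0..1}. u x = v x)"
    using S_solution_unique[OF c assms(2,3)] unfolding \<kappa> by blast
  define l0 where "l0 = (real n)\<^sup>2 * pi\<^sup>2"
  fix u :: "real \<Rightarrow> real \<Rightarrow> real"
  assume "\<forall>l > (real n)\<^sup>2 * pi\<^sup>2. S_solution \<kappa> n \<nu> l (u l)"
  then have "\<forall>l > l0. S_solution (- c\<^sup>2) n \<nu> l (u l)"
    unfolding \<kappa> l0_def .
  then obtain m where m: "\<And>l. l > l0 \<Longrightarrow> m l > 0"
    and T: "\<And>l. l > l0 \<Longrightarrow> sqrt l = real n * half_period (m l)" and pos: "\<And>l. l > l0 \<Longrightarrow> l > 0"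
    and u: "\<And>l x. l > l0 \<Longrightarrow> x \<in> {0..1} \<Longrightarrow> u l x = \<nu> * wave c (sqrt l) (m l) x"
    using S_solution_family_is_wave[OF c assms(2,3), of l0 u] by metis
  have mT: "m l \<ge> 0 \<and> sqrt l = real n * half_period (m l) \<and> l > 0" if "l > l0" for l
    using m[OF that] T[OF that] pos[OF that] by auto
  have norm: "sqrt (2 * m l) / (c * sqrt l) = sup_norm01 (u l)" if "l > l0" for l
    using wave_sup_norm[of "m l" c n \<nu> "sqrt l" "u l"] m T u that c assms by auto
  have ev_top: "\<forall>\<^sub>F l in at_top. l > l0"
    by (rule eventually_gt_at_top)
  have ev_right: "\<forall>\<^sub>F l in at_right l0. l > l0"
    by (rule eventually_at_right_less)
  have amp_top: "((\<lambda>l. sqrt (2 * m l) / (c * sqrt l)) \<longlongrightarrow> 1 / (2 * real n * c)) at_top"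
    by (rule amplitude_limit_at_top[OF c n mT])
  have amp_right: "((\<lambda>l. sqrt (2 * m l) / (c * sqrt l)) \<longlongrightarrow> 0) (at_right l0)"
    by (rule amplitude_limit_threshold[OF c n l0_def mT])
  show "(\<forall>l > (real n)\<^sup>2 * pi\<^sup>2.
            (\<forall>H\<in>humps (u l). \<forall>K\<in>humps (u l). same_hump H K)
          \<and> (\<exists>b. consecutive_zeros (u l) 0 b
                 \<and> symmetric_around (1 / (2 * real n)) (hump (u l) 0 b)))
      \<and> strict_mono_on {(real n)\<^sup>2 * pi\<^sup>2 <..} (\<lambda>l. \<nu> * D01 (u l) 0)
      \<and> (\<exists>L. ((\<lambda>l. sup_norm01 (u l)) \<longlongrightarrow> L) at_top
             \<and> L \<le> 1 / (2 * real n * sqrt (- \<kappa>)))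
      \<and> ((\<lambda>l. sup_norm01 (u l)) \<longlongrightarrow> 0) (at_right ((real n)\<^sup>2 * pi\<^sup>2))
      \<and> ((\<lambda>l. u l (1 / (2 * real n))) \<longlongrightarrow> 0) (at_right ((real n)\<^sup>2 * pi\<^sup>2))
      \<and> (\<exists>u_inf. (\<forall>x\<in>{0..1}. ((\<lambda>l. u l x) \<longlongrightarrow> u_inf x) at_top)
             \<and> (\<forall>j\<in>{0..n}. (u_inf has_real_derivative \<nu> * (-1) ^ j * (1 / sqrt (- \<kappa>)))
                    (at (real j / real n) within {0..1})))"
    unfolding l0_def[symmetric] c_def[symmetric]
  proof (intro conjI)
    show "\<forall>l > l0. (\<forall>H\<in>humps (u l). \<forall>K\<in>humps (u l). same_hump H K)
          \<and> (\<exists>b. consecutive_zeros (u l) 0 b \<and> symmetric_around (1 / (2 * real n)) (hump (u l) 0 b))"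
    proof (intro allI impI conjI)
      fix l assume l: "l > l0"
      note hyps = m[OF l] c assms(2,3) T[OF l] u[OF l]
      show "\<forall>H\<in>humps (u l). \<forall>K\<in>humps (u l). same_hump H K"
        using wave_humps_same[of "m l" c n \<nu> "sqrt l" "u l", OF hyps] by blast
      show "\<exists>b. consecutive_zeros (u l) 0 b \<and> symmetric_around (1 / (2 * real n)) (hump (u l) 0 b)"
        using wave_first_hump_symmetric[of "m l" c n \<nu> "sqrt l" "u l", OF hyps] by blast
    qed
    show "strict_mono_on {l0<..} (\<lambda>l. \<nu> * D01 (u l) 0)"
    proof (rule strict_mono_onI)
      fix k l assume kl: "k \<in> {l0<..}" "l \<in> {l0<..}" "k < l"
      have slope: "\<nu> * D01 (u l) 0 = velocity (sqrt (m l * (2 + m l))) / c" if "l > l0" for l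
      proof -
        have "D01 (u l) 0 = D01 (\<lambda>x. \<nu> * wave c (sqrt l) (m l) x) 0"
          using u[OF that] by (intro D01_cong) auto
        also have "\<dots> = \<nu> * (velocity (sqrt (m l * (2 + m l))) / c)"
          using sign_wave_D01[of "m l" c "sqrt l" 0 \<nu>] m[OF that] pos[OF that] c
          by (simp add: momentum_0)
        finally show ?thesis
          using assms(3) by auto
      qed
      have "k > l0" "l > l0" "sqrt k < sqrt l"
        using kl by auto
      then have "real n * half_period (m k) < real n * half_period (m l)"
        by (metis T)
      then have "half_period (m k) < half_period (m l)"
        using n by simp
      then have "m k < m l"
        using half_period_less_iff[of "m k" "m l"] mT[of k] mT[of l] kl by auto
      then have "m k * (2 + m k) < m l * (2 + m l)"
        using mT[of k] kl by (intro mult_strict_mono) auto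
      then show "\<nu> * D01 (u k) 0 < \<nu> * D01 (u l) 0"
        using slope kl c by (simp add: divide_strict_right_mono velocity_strict_mono)
    qed
    show "\<exists>L. ((\<lambda>l. sup_norm01 (u l)) \<longlongrightarrow> L) at_top \<and> L \<le> 1 / (2 * real n * c)"
      using Lim_transform_eventually[OF amp_top eventually_mono[OF ev_top norm]] by blast
    show "((\<lambda>l. sup_norm01 (u l)) \<longlongrightarrow> 0) (at_right l0)"
      by (rule Lim_transform_eventually[OF amp_right eventually_mono[OF ev_right norm]])
    have eq: "\<nu> * (sqrt (2 * m l) / (c * sqrt l)) = u l (1 / (2 * real n))" if "l > l0" for l
      using u[OF that, of "1 / (2 * real n)"] wave_peak[of "m l" "real n" "sqrt l" c] mT[OF that] n assms(2)
      by (simp add: divide_le_eq)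
    show "((\<lambda>l. u l (1 / (2 * real n))) \<longlongrightarrow> 0) (at_right l0)"
      using Lim_transform_eventually[OF tendsto_mult_left[OF amp_right, of \<nu>] eventually_mono[OF ev_right eq]]
      by simp
    show "\<exists>u_inf. (\<forall>x\<in>{0..1}. ((\<lambda>l. u l x) \<longlongrightarrow> u_inf x) at_top)
        \<and> (\<forall>j\<in>{0..n}. (u_inf has_real_derivative \<nu> * (-1) ^ j * (1 / c))
               (at (real j / real n) within {0..1}))"
    proof (intro exI[of _ "\<lambda>x. \<nu> * (arcsin (sin (real n * pi * x)) / (c * real n * pi))"] conjI ballI)
      fix x :: real assume x: "x \<in> {0..1}"
      have eq: "\<nu> * wave c (sqrt l) (m l) x = u l x" if "l > l0" for l
        using u[OF that x] by simp
      have "((\<lambda>l. wave c (sqrt l) (m l) x) \<longlongrightarrow> arcsin (sin (real n * pi * x)) / (c * real n * pi)) at_top"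
        by (rule wave_limit_triangle[OF c n mT])
      from tendsto_mult_left[OF this, of \<nu>]
      show "((\<lambda>l. u l x) \<longlongrightarrow> \<nu> * (arcsin (sin (real n * pi * x)) / (c * real n * pi))) at_top"
        by (rule Lim_transform_eventually[OF _ eventually_mono[OF ev_top eq]])
    next
      fix j
      have "((\<lambda>x. \<nu> * (arcsin (sin (real n * pi * x)) / (c * real n * pi))) has_real_derivative
          \<nu> * ((-1) ^ j * (real n * pi) / (c * real n * pi))) (at (real j / real n) within {0..1})"
        by (rule DERIV_cmult[OF DERIV_cdivide[OF has_field_derivative_at_within[OF
            triangle_wave_deriv[OF assms(2)]]]])
      then show "((\<lambda>x. \<nu> * (arcsin (sin (real n * pi * x)) / (c * real n * pi))) has_real_derivative
          \<nu> * (-1) ^ j * (1 / c)) (at (real j / real n) within {0..1})"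
        using n by simp
    qed
  qed
qed

end
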